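(* Let $\mathcal{F}=\{F_1(x,\bar z)=0,\ldots,F_N(x,\bar z)=0\}$, with $F_i\in\mathbb{F}_m(x)$, be a system of ordinary differential equations with radicals in the unknown functions $y_1,\ldots,y_\ell$ and their derivatives. Let $\mathcal{Q}(\bar w)=(\bar r(\bar w),\bar\delta(\bar r(\bar w)))$ be a rational parametrization of the tower variety $\mathbb{V}(\mathbb{T})$, and let $\mathcal{G}$ be the transformed system $$\mathcal{G}=\begin{cases} G_1(x,\bar w)=0,\ \ldots,\ G_N(x,\bar w)=0,\\ r_{i,j+1}(\bar w)=J_{r_{i,j}}(\bar w)\cdot(\bar w')^T,\quad 1\le i\le \ell,\ 0\le j<n_i,\end{cases}$$ where $G_k(x,\bar w):=F_k(x,\bar r(\bar w))$. Then: (1) For every solution $\bar w(x)$ of $\mathcal{G}$ such that $\bar r(\bar w(x))$ is well-defined, $(y_1(x),\ldots,y_\ell(x)):=(r_{1,0}(\bar w(x)),\ldots,r_{\ell,0}(\bar w(x)))$ is a solution of $\mathcal{F}$. (2) If $\mathcal{Q}$ is invertible, $(y_1(x),\ldots,y_\ell(x))$ is a solution of $\mathcal{F}$, and $$\bar w(x):=\mathcal{Q}^{-1}\big(y_1(x),\ldots,y_\ell^{(n_\ell)}(x),\bar\delta(y_1(x),\ldots,y_\ell^{(n_\ell)}(x))\big)$$ and $\mathcal{Q}(\bar w(x))$ are well-defined, then $\bar w(x)$ is a solution of $\mathcal{G}$.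
   Context: Setting. Let $\bar z=(z_1,\ldots,z_n)$ be variables and let $\mathbb{F}_0=\mathbb{C}(\bar z)\subseteq\mathbb{F}_1\subseteq\cdots\subseteq\mathbb{F}_m$ be a radical tower: $\mathbb{F}_i=\mathbb{F}_{i-1}(\delta_i)$ with $\delta_i^{e_i}=\alpha_i\in\mathbb{F}_{i-1}$, $e_i\in\mathbb{N}$; put $\bar\delta=(\delta_1,\ldots,\delta_m)$. Let $n=n_1+\cdots+n_\ell+\ell$; the variables $z_1,\ldots,z_n$ stand, in this order, for $y_1,y_1',\ldots,y_1^{(n_1)},\ldots,y_\ell,\ldots,y_\ell^{(n_\ell)}$, where $y_1,\ldots,y_\ell$ are unknown functions of $x$. Thus $F_k(x,\bar z)=0$ stands for $F_k(x,y_1,\ldots,y_\ell^{(n_\ell)})=0$. The $F_k\in\mathbb{F}_m(x)$ are assumed to have no denominators; in particular they are polynomials in $x$ with coefficients in $\mathbb{F}_m$. Tower variety. For a suitable choice of branches of the radicals, let $\psi(\bar z)=(\bar z,\bar\delta(\bar z))$. The tower variety $\mathbb{V}(\mathbb{T})\subset\mathbb{C}^{n+m}$ is the Zariski closure of the image of $\psi$; it is irreducible of dimension $n$, with function field $\mathbb{F}_m$. A rational parametrization $\mathcal{Q}(\bar w)$, $\bar w=(w_1,\ldots,w_n)$, is a dominant rational map $\mathbb{C}^n\dashrightarrow\mathbb{V}(\mathbb{T})$; it is invertible if it is birational, and then $\mathcal{Q}^{-1}$ is its rational inverse. Its first $n$ components are denoted $\bar r=(r_{1,0},\ldots,r_{1,n_1},\ldots,r_{\ell,0},\ldots,r_{\ell,n_\ell})\in\mathbb{C}(\bar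 w)^n$, $r_{i,j}$ being the component replacing $y_i^{(j)}$, and its last $m$ components are denoted $\bar\delta(\bar r(\bar w))\in\mathbb{C}(\bar w)^m$. $F_k(x,\bar r(\bar w))$ is obtained from $F_k$, written in terms of $x,\bar z,\bar\delta$, by substituting $(\bar z,\bar\delta)=\mathcal{Q}(\bar w)$; accordingly, along $\bar r(\bar w(x))$ the radicals $\bar\delta$ in $\mathcal{F}$ take the values $\bar\delta(\bar r(\bar w))$ at $\bar w=\bar w(x)$ (this is the choice of branch). In (2), $\bar\delta(y_1(x),\ldots,y_\ell^{(n_\ell)}(x))$ are the values of the radicals for which $(y_1,\ldots,y_\ell)$ solves $\mathcal{F}$, so that the point $(y_1(x),\ldots,y_\ell^{(n_\ell)}(x),\bar\delta(y_1(x),\ldots,y_\ell^{(n_\ell)}(x)))$ lies on $\mathbb{V}(\mathbb{T})$. $J_{r_{i,j}}=(\partial r_{i,j}/\partial w_1,\ldots,\partial r_{i,j}/\partial w_n)$ and $\bar w'=(w_1',\ldots,w_n')$, derivatives with respect to $x$. A solution of $\mathcal{G}$ is $\bar w(x)$ for which the numerators of the equations vanish and the denominators do not vanish upon substitution. A rational expression is well-defined at a function if its denominators do not vanish there. *)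

theory Defs
  imports
    "HOL-Complex_Analysis.Complex_Analysis"
    "HOL-Library.Poly_Mapping"
    "HOL-Computational_Algebra.Fraction_Field"
begin

section \<open>Polynomials and rational functions over the complex numbers\<close>

text \<open>
  The indeterminates are indexed by natural numbers, starting with 0. An affine space of
  dimension \<open>N\<close> is the set of extensional functions on \<open>{..<N}\<close>.
\<close>

type_synonym mpoly = "(nat \<Rightarrow>\<^sub>0 nat) \<Rightarrow>\<^sub>0 complex"
type_synonym ratfun = "mpoly fract"

definition vars :: "mpoly \<Rightarrow> nat set" where
  "vars p = (\<Union>m\<in>Poly_Mapping.keys p. Poly_Mapping.keys m)"

definition polys :: "nat \<Rightarrow> mpoly set" where
  "polys N = {p. vars p \<subseteq> {..<N}}"

definition ratfuns :: "nat \<Rightarrow> ratfun set" where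
  "ratfuns N = {Fract p q | p q. p \<in> polys N \<and> q \<in> polys N \<and> q \<noteq> 0}"

definition insertion :: "(complex \<Rightarrow> 'b::comm_ring_1) \<Rightarrow> (nat \<Rightarrow> 'b) \<Rightarrow> mpoly \<Rightarrow> 'b" where
  "insertion h a p =
     (\<Sum>m\<in>Poly_Mapping.keys p. h (Poly_Mapping.lookup p m) *
        (\<Prod>i\<in>Poly_Mapping.keys m. a i ^ Poly_Mapping.lookup m i))"

definition eval_poly :: "(nat \<Rightarrow> complex) \<Rightarrow> mpoly \<Rightarrow> complex" where
  "eval_poly = insertion (\<lambda>c. c)"

definition subst_poly :: "(nat \<Rightarrow> ratfun) \<Rightarrow> mpoly \<Rightarrow> ratfun" where
  "subst_poly = insertion (\<lambda>c. Fract (Poly_Mapping.single 0 c) 1)"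

definition Var :: "nat \<Rightarrow> ratfun" where
  "Var i = Fract (Poly_Mapping.single (Poly_Mapping.single i 1) 1) 1"

definition pderiv_poly :: "nat \<Rightarrow> mpoly \<Rightarrow> mpoly" where
  "pderiv_poly k p =
     (\<Sum>m\<in>Poly_Mapping.keys p. Poly_Mapping.single (m - Poly_Mapping.single k 1)
        (of_nat (Poly_Mapping.lookup m k) * Poly_Mapping.lookup p m))"

definition pderiv_rat :: "nat \<Rightarrow> ratfun \<Rightarrow> ratfun" where
  "pderiv_rat k f = (THE g. \<exists>p q. q \<noteq> 0 \<and> f = Fract p q \<and>
     g = Fract (pderiv_poly k p * q - p * pderiv_poly k q) (q * q))"

text \<open>
  As the polynomial ring is factorial, some denominator of \<open>f\<close> is nonzero at \<open>a\<close> iff the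
  denominator of \<open>f\<close> in lowest terms is nonzero at \<open>a\<close>. Likewise for \<open>vanishes_at\<close>: numerator
  zero and denominator nonzero.
\<close>

definition regular_at :: "ratfun \<Rightarrow> (nat \<Rightarrow> complex) \<Rightarrow> bool" where
  "regular_at f a \<longleftrightarrow> (\<exists>p q. q \<noteq> 0 \<and> f = Fract p q \<and> eval_poly a q \<noteq> 0)"

definition eval_rat :: "ratfun \<Rightarrow> (nat \<Rightarrow> complex) \<Rightarrow> complex" where
  "eval_rat f a = (THE v. \<exists>p q. q \<noteq> 0 \<and> f = Fract p q \<and> eval_poly a q \<noteq> 0 \<and>
     v = eval_poly a p / eval_poly a q)"

definition vanishes_at :: "ratfun \<Rightarrow> (nat \<Rightarrow> complex) \<Rightarrow> bool" where
  "vanishes_at f a \<longleftrightarrow>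
     (\<exists>p q. q \<noteq> 0 \<and> f = Fract p q \<and> eval_poly a p = 0 \<and> eval_poly a q \<noteq> 0)"


section \<open>Zariski closure and rational maps\<close>

definition affine_space :: "nat \<Rightarrow> (nat \<Rightarrow> complex) set" where
  "affine_space N = ({..<N} \<rightarrow>\<^sub>E UNIV)"

definition zariski_closure :: "nat \<Rightarrow> (nat \<Rightarrow> complex) set \<Rightarrow> (nat \<Rightarrow> complex) set" where
  "zariski_closure N S = {a \<in> affine_space N.
     \<forall>p\<in>polys N. (\<forall>s\<in>S. eval_poly s p = 0) \<longrightarrow> eval_poly a p = 0}"

text \<open>A rational map between affine spaces of dimensions \<open>N\<close> and \<open>M\<close>, with components
  \<open>f 0, \<dots>, f (M - 1)\<close>.\<close>

definition rat_dom :: "nat \<Rightarrow> nat \<Rightarrow> (nat \<Rightarrow> ratfun) \<Rightarrow> (nat \<Rightarrow> complex) set" where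
  "rat_dom N M f = {a \<in> affine_space N. \<forall>j<M. regular_at (f j) a}"

definition rat_map :: "nat \<Rightarrow> (nat \<Rightarrow> ratfun) \<Rightarrow> (nat \<Rightarrow> complex) \<Rightarrow> (nat \<Rightarrow> complex)" where
  "rat_map M f a = (\<lambda>j\<in>{..<M}. eval_rat (f j) a)"


section \<open>Radical towers, the tower variety and its parametrizations\<close>

text \<open>
  The radicals \<open>\<delta> 0, \<dots>, \<delta> (m - 1)\<close> are given by branches on a domain \<open>U\<close> of the \<open>n\<close>-dimensional
  space. Continuity of the branches suffices: a continuous root of an analytic function is analytic.
\<close>

definition space_topology :: "nat \<Rightarrow> (nat \<Rightarrow> complex) topology" where
  "space_topology N = product_topology (\<lambda>_. euclidean) {..<N}"

definition tower_point ::
    "nat \<Rightarrow> nat \<Rightarrow> (nat \<Rightarrow> (nat \<Rightarrow> complex) \<Rightarrow> complex) \<Rightarrow> (nat \<Rightarrow> complex) \<Rightarrow> (nat \<Rightarrow> complex)" where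
  "tower_point n i \<delta> z = (\<lambda>j\<in>{..<n + i}. if j < n then z j else \<delta> (j - n) z)"

text \<open>
  The \<open>i\<close>-th field of the tower, generated over the rational functions in \<open>z\<close> by the first \<open>i\<close>
  radicals and realized by functions on \<open>U\<close>: \<open>f\<close> equals \<open>A / B\<close> for polynomials \<open>A\<close>, \<open>B\<close> in \<open>z\<close>
  and these radicals, where \<open>B\<close> is not identically zero on \<open>U\<close>.
\<close>

definition tower_field ::
    "nat \<Rightarrow> (nat \<Rightarrow> complex) set \<Rightarrow> (nat \<Rightarrow> (nat \<Rightarrow> complex) \<Rightarrow> complex) \<Rightarrow> nat \<Rightarrow>
     ((nat \<Rightarrow> complex) \<Rightarrow> complex) set" where
  "tower_field n U \<delta> i = {f. \<exists>A\<in>polys (n + i). \<exists>B\<in>polys (n + i).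
     (\<exists>z\<in>U. eval_poly (tower_point n i \<delta> z) B \<noteq> 0) \<and>
     (\<forall>z\<in>U. eval_poly (tower_point n i \<delta> z) B * f z = eval_poly (tower_point n i \<delta> z) A)}"

definition radical_tower ::
    "nat \<Rightarrow> nat \<Rightarrow> (nat \<Rightarrow> complex) set \<Rightarrow> (nat \<Rightarrow> (nat \<Rightarrow> complex) \<Rightarrow> complex) \<Rightarrow>
     (nat \<Rightarrow> nat) \<Rightarrow> bool" where
  "radical_tower n m U \<delta> e \<longleftrightarrow>
     openin (space_topology n) U \<and> connectedin (space_topology n) U \<and> U \<noteq> {} \<and>
     (\<forall>i<m. continuous_map (subtopology (space_topology n) U) euclidean (\<delta> i) \<and>
            e i > 0 \<and> (\<lambda>z. \<delta> i z ^ e i) \<in> tower_field n U \<delta> i)"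

definition tower_variety ::
    "nat \<Rightarrow> nat \<Rightarrow> (nat \<Rightarrow> complex) set \<Rightarrow> (nat \<Rightarrow> (nat \<Rightarrow> complex) \<Rightarrow> complex) \<Rightarrow>
     (nat \<Rightarrow> complex) set" where
  "tower_variety n m U \<delta> = zariski_closure (n + m) (tower_point n m \<delta> ` U)"

text \<open>The closure condition says both that \<open>Q\<close> maps into \<open>V\<close> and that it is dominant.\<close>

definition rational_parametrization ::
    "nat \<Rightarrow> nat \<Rightarrow> (nat \<Rightarrow> complex) set \<Rightarrow> (nat \<Rightarrow> ratfun) \<Rightarrow> bool" where
  "rational_parametrization n m V Q \<longleftrightarrow>
     (\<forall>j<n + m. Q j \<in> ratfuns n) \<and>
     zariski_closure (n + m) (rat_map (n + m) Q ` rat_dom n (n + m) Q) = V"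

text \<open>
  \<open>R\<close>, a tuple of rational functions of the ambient space restricted to \<open>V\<close>, is inverse to \<open>Q\<close>:
  each of the two composites is defined and equal to the identity on a dense set. (Every rational
  map on \<open>V\<close> is such a restriction; the density condition ensures that the denominators of \<open>R\<close> do
  not vanish identically on \<open>V\<close>.)
\<close>

definition rational_inverse ::
    "nat \<Rightarrow> nat \<Rightarrow> (nat \<Rightarrow> complex) set \<Rightarrow> (nat \<Rightarrow> ratfun) \<Rightarrow> (nat \<Rightarrow> ratfun) \<Rightarrow> bool" where
  "rational_inverse n m V Q R \<longleftrightarrow>
     (\<forall>k<n. R k \<in> ratfuns (n + m)) \<and>
     affine_space n \<subseteq> zariski_closure n
       {a \<in> rat_dom n (n + m) Q. rat_map (n + m) Q a \<in> rat_dom (n + m) n R \<and>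
          rat_map n R (rat_map (n + m) Q a) = a} \<and>
     V \<subseteq> zariski_closure (n + m)
       {b \<in> V \<inter> rat_dom (n + m) n R. rat_map n R b \<in> rat_dom n (n + m) Q \<and>
          rat_map (n + m) Q (rat_map n R b) = b}"


section \<open>The differential systems\<close>

text \<open>
  \<open>ns = [n\<^sub>1, \<dots>, n\<^sub>\<ell>]\<close> lists the orders. The unknowns are \<open>y 0, \<dots>, y (\<ell> - 1)\<close>, and \<open>idx ns i j\<close> is the
  position of the \<open>j\<close>-th derivative of \<open>y i\<close> in the list of all the variables \<open>z\<close>.
\<close>

definition idx :: "nat list \<Rightarrow> nat \<Rightarrow> nat \<Rightarrow> nat" where
  "idx ns i j = (\<Sum>k<i. Suc (ns ! k)) + j"

definition jet :: "nat list \<Rightarrow> (nat \<Rightarrow> complex \<Rightarrow> complex) \<Rightarrow> complex \<Rightarrow> complex list" where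
  "jet ns y x =
     concat (map (\<lambda>i. map (\<lambda>j. (deriv ^^ j) (y i) x) [0..<Suc (ns ! i)]) [0..<length ns])"

definition curve_point :: "nat \<Rightarrow> (nat \<Rightarrow> complex \<Rightarrow> complex) \<Rightarrow> complex \<Rightarrow> (nat \<Rightarrow> complex)" where
  "curve_point n w x = (\<lambda>k\<in>{..<n}. w k x)"

text \<open>The variables \<open>z\<close> replaced by \<open>y\<close> and its derivatives, the radicals replaced by \<open>d\<close>.\<close>

definition jet_point ::
    "nat \<Rightarrow> nat \<Rightarrow> nat list \<Rightarrow> (nat \<Rightarrow> complex \<Rightarrow> complex) \<Rightarrow> (nat \<Rightarrow> complex \<Rightarrow> complex) \<Rightarrow>
     complex \<Rightarrow> (nat \<Rightarrow> complex)" where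
  "jet_point n m ns y d x = (\<lambda>j\<in>{..<n + m}. if j < n then jet ns y x ! j else d (j - n) x)"

definition radicals_of :: "nat \<Rightarrow> nat \<Rightarrow> nat \<Rightarrow> (nat \<Rightarrow> mpoly) \<Rightarrow> nat set" where
  "radicals_of n m N F = {i. i < m \<and> (\<exists>k<N. n + i \<in> vars (F k))}"

text \<open>
  The left-hand sides \<open>F 0, \<dots>, F (N - 1)\<close> are polynomials in \<open>z\<close> (indices \<open>0, \<dots>, n - 1\<close>), the
  radicals (\<open>n, \<dots>, n + m - 1\<close>) and \<open>x\<close> (index \<open>n + m\<close>). The functions \<open>y\<close> solve the system on \<open>D\<close>
  when the radicals occurring in it take the values \<open>d\<close>. That \<open>d\<close> are values of these radicals along
  \<open>y\<close> means that every polynomial relation which they satisfy together with \<open>z\<close> on the tower variety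
  \<open>V\<close> holds along \<open>y\<close> and \<open>d\<close>; if all radicals occur, this says that the points lie on \<open>V\<close>.
\<close>

definition solves_F ::
    "nat \<Rightarrow> nat \<Rightarrow> (nat \<Rightarrow> complex) set \<Rightarrow> nat list \<Rightarrow> nat \<Rightarrow> (nat \<Rightarrow> mpoly) \<Rightarrow> complex set \<Rightarrow>
     (nat \<Rightarrow> complex \<Rightarrow> complex) \<Rightarrow> (nat \<Rightarrow> complex \<Rightarrow> complex) \<Rightarrow> bool" where
  "solves_F n m V ns N F D y d \<longleftrightarrow>
     (\<forall>i<length ns. y i holomorphic_on D) \<and>
     (\<forall>i\<in>radicals_of n m N F. d i holomorphic_on D) \<and>
     (\<forall>x\<in>D. \<forall>p. vars p \<subseteq> {..<n} \<union> (+) n ` radicals_of n m N F \<longrightarrow>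
        (\<forall>b\<in>V. eval_poly b p = 0) \<longrightarrow> eval_poly (jet_point n m ns y d x) p = 0) \<and>
     (\<forall>x\<in>D. \<forall>k<N. eval_poly ((jet_point n m ns y d x)(n + m := x)) (F k) = 0)"

text \<open>
  The transformed system consists of rational functions in \<open>w\<close> (indices \<open>0, \<dots>, n - 1\<close>), \<open>w'\<close>
  (\<open>n, \<dots>, 2 n - 1\<close>) and \<open>x\<close> (index \<open>2 n\<close>).
\<close>

definition G_eq :: "nat \<Rightarrow> nat \<Rightarrow> (nat \<Rightarrow> ratfun) \<Rightarrow> mpoly \<Rightarrow> ratfun" where
  "G_eq n m Q f = subst_poly (\<lambda>j. if j < n + m then Q j else Var (2 * n)) f"

definition D_eq :: "nat \<Rightarrow> nat list \<Rightarrow> (nat \<Rightarrow> ratfun) \<Rightarrow> nat \<Rightarrow> nat \<Rightarrow> ratfun" where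
  "D_eq n ns Q i j = Q (idx ns i (Suc j)) - (\<Sum>k<n. pderiv_rat k (Q (idx ns i j)) * Var (n + k))"

definition ode_point :: "nat \<Rightarrow> (nat \<Rightarrow> complex \<Rightarrow> complex) \<Rightarrow> complex \<Rightarrow> (nat \<Rightarrow> complex)" where
  "ode_point n w x =
     (\<lambda>k. if k < n then w k x else if k < 2 * n then deriv (w (k - n)) x else x)"

text \<open>
  The denominators of the expression \<open>G\<^sub>k = F\<^sub>k(x, Q(w))\<close> include those of the substituted components
  of \<open>Q\<close>, even if they cancel in the resulting rational function: with \<open>Q = (w\<^sup>2, 1/w)\<close>,
  \<open>\<delta>\<^sup>2 = 1/z\<close> and \<open>F = z \<delta>\<close> one gets \<open>G = w\<close>, but \<open>w = 0\<close> would lead to \<open>y = 0\<close>, where \<open>\<delta>\<close>, and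
  hence \<open>F\<close>, has no value.
\<close>

definition solves_G ::
    "nat \<Rightarrow> nat \<Rightarrow> nat list \<Rightarrow> nat \<Rightarrow> (nat \<Rightarrow> mpoly) \<Rightarrow> (nat \<Rightarrow> ratfun) \<Rightarrow> complex set \<Rightarrow>
     (nat \<Rightarrow> complex \<Rightarrow> complex) \<Rightarrow> bool" where
  "solves_G n m ns N F Q D w \<longleftrightarrow>
     (\<forall>k<n. w k holomorphic_on D) \<and>
     (\<forall>x\<in>D. \<forall>k<N.
        (\<forall>j\<in>vars (F k) \<inter> {..<n + m}. regular_at (Q j) (curve_point n w x)) \<and>
        vanishes_at (G_eq n m Q (F k)) (ode_point n w x)) \<and>
     (\<forall>x\<in>D. \<forall>i<length ns. \<forall>j<ns ! i. vanishes_at (D_eq n ns Q i j) (ode_point n w x))"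

end

theory Submission
  imports Defs
begin

text \<open>
  Along a solution of \<open>\<G>\<close> the chain rule turns the differential equations of \<open>\<G>\<close> into the statement
  that the components of \<open>Q(w(x))\<close> are the successive derivatives of the \<open>y\<^sub>i\<close>, so \<open>G\<^sub>k = 0\<close> becomes \<open>F\<^sub>k = 0\<close>.
  Conversely, \<open>Q(Q\<inverse>(b)) = b\<close> holds at every point \<open>b\<close> of the tower variety where it is defined,
  because it holds on a dense set; so \<open>Q(w(x))\<close> is the jet of \<open>y\<close>, and the same computation can be
  read backwards.
\<close>

section \<open>Polynomials\<close>

text \<open>The obstacle is that a rational function has a value only where some representation has
  a nonvanishing denominator, and a suitable representation depends on the point. Values are
  therefore computed by rules with regularity as a side condition, and extension from a dense set
  goes through polynomials multiplied by denominators: where a denominator vanishes the product is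
  trivially zero, elsewhere it cancels. Two further difficulties shape the lemmas. A denominator may
  contain indeterminates foreign to the function; \<open>specialize\<close> removes them, so that
  values at \<open>w\<close> and at (\<open>w\<close>, \<open>w'\<close>, \<open>x\<close>) can be
  compared. And a radical absent from all equations may have a pole along the curve, so that Q(w(x))
  need not be a point of \<open>V\<close>; hence regularity is tracked for the occurring variables
  only, and polynomial relations replace membership in \<open>V\<close>.\<close>

definition mono_eval :: "(nat \<Rightarrow> 'b::comm_ring_1) \<Rightarrow> (nat \<Rightarrow>\<^sub>0 nat) \<Rightarrow> 'b" where
  "mono_eval a m = (\<Prod>i\<in>Poly_Mapping.keys m. a i ^ Poly_Mapping.lookup m i)"

lemma mono_eval_superset:
  assumes "finite S" "Poly_Mapping.keys m \<subseteq> S"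
  shows "mono_eval a m = (\<Prod>i\<in>S. a i ^ Poly_Mapping.lookup m i)"
  unfolding mono_eval_def using assms
  by (intro prod.mono_neutral_left) (auto simp: in_keys_iff)

lemma mono_eval_0 [simp]: "mono_eval a 0 = 1"
  by (simp add: mono_eval_def)

lemma mono_eval_single [simp]: "mono_eval a (Poly_Mapping.single i k) = a i ^ k"
  by (simp add: mono_eval_def)

lemma mono_eval_add: "mono_eval a (m + m') = mono_eval a m * mono_eval a m'"
proof -
  let ?S = "Poly_Mapping.keys m \<union> Poly_Mapping.keys m'"
  have "mono_eval a (m + m') = (\<Prod>i\<in>?S. a i ^ Poly_Mapping.lookup (m + m') i)"
    using keys_add[of m m'] by (intro mono_eval_superset) auto
  also have "\<dots> = (\<Prod>i\<in>?S. a i ^ Poly_Mapping.lookup m i) * (\<Prod>i\<in>?S. a i ^ Poly_Mapping.lookup m' i)"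
    by (simp add: lookup_add power_add prod.distrib)
  also have "\<dots> = mono_eval a m * mono_eval a m'"
    by (subst (1 2) mono_eval_superset[of ?S]) auto
  finally show ?thesis .
qed

section \<open>Substitution into polynomials as a ring homomorphism\<close>

lemma insertion_superset:
  assumes "h 0 = 0" "finite S" "Poly_Mapping.keys p \<subseteq> S"
  shows "insertion h a p = (\<Sum>m\<in>S. h (Poly_Mapping.lookup p m) * mono_eval a m)"
  unfolding insertion_def mono_eval_def[symmetric] using assms
  by (intro sum.mono_neutral_left) (auto simp: in_keys_iff)

lemma sum_monomials: "(\<Sum>m\<in>Poly_Mapping.keys p. Poly_Mapping.single m (Poly_Mapping.lookup p m)) = p"
  by (rule poly_mapping_eqI)
    (auto simp: lookup_sum lookup_single when_def in_keys_iff)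

lemma insertion_cong:
  assumes "\<And>i. i \<in> vars p \<Longrightarrow> a i = b i"
  shows "insertion h a p = insertion h b p"
  unfolding insertion_def
  by (intro sum.cong arg_cong2[of _ _ _ _ "(*)"] prod.cong refl)
    (use assms in \<open>force simp: vars_def\<close>)

lemma insertion_single:
  assumes "h 0 = 0"
  shows "insertion h a (Poly_Mapping.single m c) = h c * mono_eval a m"
  by (subst insertion_superset[of _ "{m}"]) (use assms in auto)

context
  fixes h :: "complex \<Rightarrow> 'b::comm_ring_1"
  assumes h0: "h 0 = 0" and h_add: "\<And>c d. h (c + d) = h c + h d"
begin

lemma insertion_zero: "insertion h a 0 = 0"
  by (simp add: insertion_def)

lemma insertion_add: "insertion h a (p + q) = insertion h a p + insertion h a q"
proof -
  let ?S = "Poly_Mapping.keys p \<union> Poly_Mapping.keys q"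
  have "insertion h a (p + q) = (\<Sum>m\<in>?S. h (Poly_Mapping.lookup (p + q) m) * mono_eval a m)"
    using keys_add[of p q] h0 by (intro insertion_superset) auto
  also have "\<dots> = (\<Sum>m\<in>?S. h (Poly_Mapping.lookup p m) * mono_eval a m) +
      (\<Sum>m\<in>?S. h (Poly_Mapping.lookup q m) * mono_eval a m)"
    by (simp add: lookup_add h_add distrib_right sum.distrib)
  also have "\<dots> = insertion h a p + insertion h a q"
    by (subst (1 2) insertion_superset[of _ ?S]) (use h0 in auto)
  finally show ?thesis .
qed

lemma insertion_sum: "insertion h a (\<Sum>i\<in>A. f i) = (\<Sum>i\<in>A. insertion h a (f i))"
  by (induction A rule: infinite_finite_induct) (auto simp: insertion_zero insertion_add)

lemma insertion_uminus: "insertion h a (- p) = - insertion h a p"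
  using insertion_add[of a p "- p"] by (simp add: insertion_zero eq_neg_iff_add_eq_0 add.commute)

text \<open>Expanding both factors into monomials reduces the convolution product to
  \<open>mult_single\<close>. The coefficient map stays general because two are used: the identity
  for \<open>eval_poly\<close> and the embedding of constants for \<open>specialize\<close>.\<close>

lemma insertion_mult:
  assumes h_mult: "\<And>c d. h (c * d) = h c * h d"
  shows "insertion h a (p * q) = insertion h a p * insertion h a q"
proof -
  let ?s = "\<lambda>p m. Poly_Mapping.single m (Poly_Mapping.lookup p m)"
  have "p * q = (\<Sum>m\<in>Poly_Mapping.keys p. \<Sum>m'\<in>Poly_Mapping.keys q. ?s p m * ?s q m')"
    by (subst (1 2) sum_monomials[symmetric]) (simp only: sum_product)
  also have "insertion h a \<dots> = (\<Sum>m\<in>Poly_Mapping.keys p. \<Sum>m'\<in>Poly_Mapping.keys q.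
      (h (Poly_Mapping.lookup p m) * mono_eval a m) * (h (Poly_Mapping.lookup q m') * mono_eval a m'))"
    by (simp add: insertion_sum mult_single insertion_single[of h, OF h0] h_mult mono_eval_add ac_simps)
  also have "\<dots> = insertion h a p * insertion h a q"
    by (simp add: insertion_def mono_eval_def sum_product)
  finally show ?thesis .
qed

end

lemma eval_poly_0 [simp]: "eval_poly a 0 = 0"
  and eval_poly_add: "eval_poly a (p + q) = eval_poly a p + eval_poly a q"
  and eval_poly_uminus: "eval_poly a (- p) = - eval_poly a p"
  and eval_poly_sum: "eval_poly a (\<Sum>i\<in>A. f i) = (\<Sum>i\<in>A. eval_poly a (f i))"
  and eval_poly_mult: "eval_poly a (p * q) = eval_poly a p * eval_poly a q"
  and eval_poly_single: "eval_poly a (Poly_Mapping.single m c) = c * mono_eval a m"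
  unfolding eval_poly_def
  by (auto simp: insertion_zero insertion_add insertion_uminus insertion_sum insertion_mult insertion_single)

lemma eval_poly_diff: "eval_poly a (p - q) = eval_poly a p - eval_poly a q"
  using eval_poly_add[of a p "- q"] by (simp add: eval_poly_uminus)

lemma eval_poly_1 [simp]: "eval_poly a 1 = 1"
  using eval_poly_single[of a 0 1] by simp

lemma eval_poly_prod: "eval_poly a (\<Prod>i\<in>A. f i) = (\<Prod>i\<in>A. eval_poly a (f i))"
  by (induction A rule: infinite_finite_induct) (auto simp: eval_poly_mult)

lemma eval_poly_power: "eval_poly a (p ^ k) = eval_poly a p ^ k"
  by (induction k) (auto simp: eval_poly_mult)

lemma eval_poly_cong: "(\<And>i. i \<in> vars p \<Longrightarrow> a i = b i) \<Longrightarrow> eval_poly a p = eval_poly b p"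
  unfolding eval_poly_def by (rule insertion_cong)

lemma eval_poly_cong_polys:
  "p \<in> polys N \<Longrightarrow> (\<And>i. i < N \<Longrightarrow> a i = b i) \<Longrightarrow> eval_poly a p = eval_poly b p"
  by (rule eval_poly_cong) (auto simp: polys_def)

lemma eval_poly_alt: "eval_poly a p =
    (\<Sum>m\<in>Poly_Mapping.keys p. Poly_Mapping.lookup p m * mono_eval a m)"
  by (simp add: eval_poly_def insertion_def mono_eval_def)

section \<open>Polynomials in the first \<open>N\<close> indeterminates\<close>

lemma polys_iff: "p \<in> polys N \<longleftrightarrow> (\<forall>m\<in>Poly_Mapping.keys p. Poly_Mapping.keys m \<subseteq> {..<N})"
  by (auto simp: polys_def vars_def)

lemma ex_polys: "\<exists>N. p \<in> polys N"
proof -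
  have "finite (vars p)" by (simp add: vars_def)
  then show ?thesis by (simp add: polys_def finite_nat_iff_bounded)
qed

lemma polys_mono: "p \<in> polys N \<Longrightarrow> N \<le> M \<Longrightarrow> p \<in> polys M"
  by (force simp: polys_def)

lemma polys_single: "Poly_Mapping.keys m \<subseteq> {..<N} \<Longrightarrow> Poly_Mapping.single m c \<in> polys N"
  by (simp add: polys_iff)

lemma polys_0 [simp]: "0 \<in> polys N" and polys_1 [simp]: "1 \<in> polys N"
  by (auto simp: polys_iff)

lemma polys_add: "p \<in> polys N \<Longrightarrow> q \<in> polys N \<Longrightarrow> p + q \<in> polys N"
  unfolding polys_iff using keys_add[of p q] by blast

lemma polys_uminus: "p \<in> polys N \<Longrightarrow> - p \<in> polys N"
  unfolding polys_iff by (simp add: in_keys_iff)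

lemma polys_mult: "p \<in> polys N \<Longrightarrow> q \<in> polys N \<Longrightarrow> p * q \<in> polys N"
  unfolding polys_iff
proof
  fix m assume p: "\<forall>m\<in>Poly_Mapping.keys p. Poly_Mapping.keys m \<subseteq> {..<N}"
    and q: "\<forall>m\<in>Poly_Mapping.keys q. Poly_Mapping.keys m \<subseteq> {..<N}"
    and "m \<in> Poly_Mapping.keys (p * q)"
  then obtain k l where "m = k + l" "k \<in> Poly_Mapping.keys p" "l \<in> Poly_Mapping.keys q"
    using keys_mult[of p q] by blast
  with p q show "Poly_Mapping.keys m \<subseteq> {..<N}"
    using keys_add[of k l] by blast
qed

lemma polys_sum: "(\<And>i. i \<in> A \<Longrightarrow> f i \<in> polys N) \<Longrightarrow> (\<Sum>i\<in>A. f i) \<in> polys N"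
  by (induction A rule: infinite_finite_induct) (auto intro: polys_add)

lemma polys_power: "p \<in> polys N \<Longrightarrow> p ^ k \<in> polys N"
  by (induction k) (auto intro: polys_mult)

lemma polys_prod: "(\<And>i. i \<in> A \<Longrightarrow> f i \<in> polys N) \<Longrightarrow> (\<Prod>i\<in>A. f i) \<in> polys N"
  by (induction A rule: infinite_finite_induct) (auto intro: polys_mult)

text \<open>This ring homomorphism fixes \<open>polys N\<close> and preserves the value at
  \<open>a\<close>. It can thus rid a denominator of foreign indeterminates without losing that it
  is nonzero at \<open>a\<close>, and without unique factorization.\<close>

definition specialize :: "nat \<Rightarrow> (nat \<Rightarrow> complex) \<Rightarrow> mpoly \<Rightarrow> mpoly" where
  "specialize N a = insertion (Poly_Mapping.single 0)
     (\<lambda>i. if i < N then Poly_Mapping.single (Poly_Mapping.single i 1) 1 else Poly_Mapping.single 0 (a i))"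

lemma specialize_mult: "specialize N a (p * q) = specialize N a p * specialize N a q"
  unfolding specialize_def by (rule insertion_mult) (auto simp: single_add mult_single)


lemma specialize_polys: "specialize N a p \<in> polys N"
  unfolding specialize_def insertion_def
  by (intro polys_sum polys_mult polys_single polys_prod polys_power) (auto intro!: polys_single)

lemma eval_specialize:
  assumes "\<And>i. i < N \<Longrightarrow> b i = a i"
  shows "eval_poly b (specialize N a p) = eval_poly a p"
proof -
  have *: "eval_poly b (if i < N then Poly_Mapping.single (Poly_Mapping.single i 1) 1
      else Poly_Mapping.single 0 (a i)) = a i" for i
    using assms by (simp add: eval_poly_single)
  show ?thesis
    unfolding specialize_def insertion_def
    by (simp add: eval_poly_sum eval_poly_mult eval_poly_prod eval_poly_power * eval_poly_single
          eval_poly_alt[of a] mono_eval_def del: One_nat_def)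
qed

lemma prod_single:
  "(\<Prod>i\<in>A. Poly_Mapping.single (f i) (1::complex)) = Poly_Mapping.single (\<Sum>i\<in>A. f i) 1"
  for f :: "nat \<Rightarrow> nat \<Rightarrow>\<^sub>0 nat"
  by (induction A rule: infinite_finite_induct) (auto simp: mult_single single_one)

lemma single_one_power:
  "Poly_Mapping.single (Poly_Mapping.single i 1) (1::complex) ^ k
    = Poly_Mapping.single (Poly_Mapping.single i k) 1" for i k :: nat
  by (induction k) (auto simp: mult_single single_add[symmetric] single_one)

lemma specialize_id:
  assumes "p \<in> polys N"
  shows "specialize N a p = p"
proof -
  have "(\<Prod>i\<in>Poly_Mapping.keys m. (if i < N then Poly_Mapping.single (Poly_Mapping.single i 1) 1
      else Poly_Mapping.single 0 (a i)) ^ Poly_Mapping.lookup m i) = Poly_Mapping.single m 1"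
    if "m \<in> Poly_Mapping.keys p" for m
  proof -
    have "(\<Prod>i\<in>Poly_Mapping.keys m. (if i < N then Poly_Mapping.single (Poly_Mapping.single i 1) 1
      else Poly_Mapping.single 0 (a i)) ^ Poly_Mapping.lookup m i) =
      (\<Prod>i\<in>Poly_Mapping.keys m. Poly_Mapping.single (Poly_Mapping.single i (Poly_Mapping.lookup m i)) 1)"
      using assms that by (intro prod.cong refl) (auto simp: polys_iff single_one_power simp del: One_nat_def)
    then show ?thesis by (simp add: prod_single sum_monomials)
  qed
  then have "specialize N a p = (\<Sum>m\<in>Poly_Mapping.keys p. Poly_Mapping.single m (Poly_Mapping.lookup p m))"
    unfolding specialize_def insertion_def by (simp add: mult_single)
  then show ?thesis by (simp add: sum_monomials)
qed

section \<open>Formal derivatives and the polynomial identity principle\<close>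

lemma lookup_pderiv_poly:
  "Poly_Mapping.lookup (pderiv_poly k p) m =
     of_nat (Suc (Poly_Mapping.lookup m k)) * Poly_Mapping.lookup p (m + Poly_Mapping.single k 1)"
proof -
  let ?e = "Poly_Mapping.single k (1::nat)"
  have *: "Poly_Mapping.lookup (Poly_Mapping.single (m' - ?e)
        (of_nat (Poly_Mapping.lookup m' k) * Poly_Mapping.lookup p m')) m =
      (if m' = m + ?e then of_nat (Suc (Poly_Mapping.lookup m k)) * Poly_Mapping.lookup p m' else 0)" for m'
  \<comment> \<open>Exponents are subtracted with truncation, so a monomial free of \<open>k\<close>
    keeps its exponent instead of disappearing; its coefficient 0 is what removes it.\<close>
  proof (cases "Poly_Mapping.lookup m' k = 0")
    case True
    then have "m' \<noteq> m + ?e" by (auto simp: lookup_add)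
    with True show ?thesis by simp
  next
    case False
    have "m' - ?e + ?e = m'"
      by (rule poly_mapping_eqI) (use False in \<open>auto simp: lookup_add lookup_minus lookup_single when_def\<close>)
    then have "m' - ?e = m \<longleftrightarrow> m' = m + ?e" by (metis add_right_cancel)
    then show ?thesis by (auto simp: lookup_single when_def lookup_add)
  qed
  show ?thesis
    unfolding pderiv_poly_def lookup_sum *
    by (auto simp: in_keys_iff)
qed

lemma has_field_derivative_eval_poly:
  assumes p: "p \<in> polys N"
    and u: "\<And>i. i < N \<Longrightarrow> ((\<lambda>x. u x i) has_field_derivative u' i) (at x0)"
  shows "((\<lambda>x. eval_poly (u x) p) has_field_derivative
           (\<Sum>k<N. eval_poly (u x0) (pderiv_poly k p) * u' k)) (at x0)"
proof -
  let ?c = "Poly_Mapping.lookup p" and ?l = Poly_Mapping.lookup and ?e = "\<lambda>k. Poly_Mapping.single k (1::nat)"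
  have mono: "((\<lambda>x. mono_eval (u x) m) has_field_derivative
      (\<Sum>k<N. of_nat (?l m k) * mono_eval (u x0) (m - ?e k) * u' k)) (at x0)"
    if m: "m \<in> Poly_Mapping.keys p" for m
  proof -
    have keys: "Poly_Mapping.keys m \<subseteq> {..<N}" using p m by (auto simp: polys_iff)
    then have keys': "Poly_Mapping.keys (m - ?e k) \<subseteq> {..<N}" for k
      by (auto simp: in_keys_iff lookup_minus subset_eq)
    have "((\<lambda>x. \<Prod>i<N. u x i ^ ?l m i) has_field_derivative
      (\<Sum>k<N. (of_nat (?l m k) * (u' k * u x0 k ^ (?l m k - 1))) * (\<Prod>i\<in>{..<N}-{k}. u x0 i ^ ?l m i))) (at x0)"
      by (intro has_field_derivative_prod) (use u in \<open>auto intro!: derivative_eq_intros\<close>)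
    also have "(\<lambda>x. \<Prod>i<N. u x i ^ ?l m i) = (\<lambda>x. mono_eval (u x) m)"
      using keys by (simp add: mono_eval_superset[of "{..<N}"])
    also have "(\<Sum>k<N. (of_nat (?l m k) * (u' k * u x0 k ^ (?l m k - 1))) * (\<Prod>i\<in>{..<N}-{k}. u x0 i ^ ?l m i)) =
      (\<Sum>k<N. of_nat (?l m k) * mono_eval (u x0) (m - ?e k) * u' k)"
    proof (intro sum.cong refl)
      fix k assume k: "k \<in> {..<N}"
      have "mono_eval (u x0) (m - ?e k) = (\<Prod>i<N. u x0 i ^ ?l (m - ?e k) i)"
        using keys' by (intro mono_eval_superset) auto
      \<comment> \<open>Both sides truncate the exponent in the same way, so the case of exponent 0
        needs no separate treatment.\<close>
      also have "\<dots> = u x0 k ^ (?l m k - 1) * (\<Prod>i\<in>{..<N}-{k}. u x0 i ^ ?l m i)"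
        using k by (subst prod.remove[of _ k])
          (auto simp: lookup_minus lookup_single when_def intro!: prod.cong)
      finally show "(of_nat (?l m k) * (u' k * u x0 k ^ (?l m k - 1))) * (\<Prod>i\<in>{..<N}-{k}. u x0 i ^ ?l m i)
        = of_nat (?l m k) * mono_eval (u x0) (m - ?e k) * u' k" by (simp add: ac_simps)
    qed
    finally show ?thesis .
  qed
  have "((\<lambda>x. \<Sum>m\<in>Poly_Mapping.keys p. ?c m * mono_eval (u x) m) has_field_derivative
     (\<Sum>m\<in>Poly_Mapping.keys p. ?c m * (\<Sum>k<N. of_nat (?l m k) * mono_eval (u x0) (m - ?e k) * u' k))) (at x0)"
    by (intro DERIV_sum DERIV_cmult mono)
  also have "(\<Sum>m\<in>Poly_Mapping.keys p. ?c m * (\<Sum>k<N. of_nat (?l m k) * mono_eval (u x0) (m - ?e k) * u' k)) =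
     (\<Sum>k<N. eval_poly (u x0) (pderiv_poly k p) * u' k)"
    unfolding pderiv_poly_def eval_poly_sum eval_poly_single sum_distrib_left sum_distrib_right
    by (subst sum.swap) (simp add: ac_simps)
  finally show ?thesis by (simp add: eval_poly_alt)
qed

text \<open>Restricting to a coordinate line identifies the formal derivative with an analytic one,
  so that uniqueness of derivatives yields formal identities.\<close>

lemma has_field_derivative_eval_poly_fun_upd:
  "((\<lambda>t. eval_poly (a(k := t)) p) has_field_derivative eval_poly a (pderiv_poly k p)) (at (a k))"
proof -
  obtain N0 where "p \<in> polys N0" using ex_polys by blast
  \<comment> \<open>The bound must exceed \<open>k\<close> too: the sum over coordinates has to
    contain the one that moves.\<close>
  then have p: "p \<in> polys (max N0 (Suc k))" by (rule polys_mono) simp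
  have "((\<lambda>t. eval_poly (a(k := t)) p) has_field_derivative
      (\<Sum>i<max N0 (Suc k). eval_poly (a(k := a k)) (pderiv_poly i p) * (if i = k then 1 else 0))) (at (a k))"
    by (rule has_field_derivative_eval_poly[OF p]) (auto intro!: derivative_eq_intros)
  then show ?thesis by (simp add: if_distrib less_max_iff_disj cong: if_cong)
qed

text \<open>Differentiating lowers the degree, and vanishing derivatives leave only the constant term.\<close>

lemma poly_eq_0I:
  assumes "\<And>a. eval_poly a p = 0"
  shows "p = 0"
proof -
  define deg where "deg m = (\<Sum>i\<in>Poly_Mapping.keys m. Poly_Mapping.lookup m i)" for m :: "nat \<Rightarrow>\<^sub>0 nat"
  have deg_Suc: "deg (m + Poly_Mapping.single k 1) = Suc (deg m)" for m k
  proof -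
    let ?S = "insert k (Poly_Mapping.keys m)"
    have sup: "deg m' = (\<Sum>i\<in>?S. Poly_Mapping.lookup m' i)" if "Poly_Mapping.keys m' \<subseteq> ?S" for m'
      unfolding deg_def using that by (intro sum.mono_neutral_left) (auto simp: in_keys_iff)
    have "deg (m + Poly_Mapping.single k 1) =
        (\<Sum>i\<in>?S. Poly_Mapping.lookup m i + (if i = k then 1 else 0))"
      using keys_add[of m "Poly_Mapping.single k 1"]
      by (subst sup) (auto simp: lookup_add lookup_single when_def intro!: sum.cong)
    also have "\<dots> = (\<Sum>i\<in>?S. Poly_Mapping.lookup m i) + (\<Sum>i\<in>?S. if i = k then 1 else 0)"
      by (rule sum.distrib)
    finally show ?thesis by (simp add: sup[of m, OF subset_insertI])
  qed
  \<comment> \<open>The degree bound is strict, so \<open>d = 0\<close> leaves no monomials at all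
    and is a trivial base case.\<close>
  have "(\<forall>m\<in>Poly_Mapping.keys p. deg m < d) \<Longrightarrow> (\<forall>a. eval_poly a p = 0) \<Longrightarrow> p = 0" for d
  proof (induction d arbitrary: p)
    case (Suc d)
    have pd: "pderiv_poly k p = 0" for k
    proof (rule Suc.IH)
      show "\<forall>m\<in>Poly_Mapping.keys (pderiv_poly k p). deg m < d"
      proof
        fix m assume "m \<in> Poly_Mapping.keys (pderiv_poly k p)"
        then have "m + Poly_Mapping.single k 1 \<in> Poly_Mapping.keys p"
          by (auto simp: in_keys_iff lookup_pderiv_poly)
        with Suc.prems(1) have "deg (m + Poly_Mapping.single k 1) < Suc d" by blast
        then show "deg m < d" by (simp only: deg_Suc)
      qed
      show "\<forall>a. eval_poly a (pderiv_poly k p) = 0"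
      proof
        fix a
        have "((\<lambda>t. 0) has_field_derivative eval_poly a (pderiv_poly k p)) (at (a k))"
          using has_field_derivative_eval_poly_fun_upd[of a k p] Suc.prems(2) by simp
        then show "eval_poly a (pderiv_poly k p) = 0"
          using DERIV_const DERIV_unique by blast
      qed
    qed
    have nz: "Poly_Mapping.lookup p m = 0" if "m \<noteq> 0" for m
    proof -
      from that obtain k where k: "Poly_Mapping.lookup m k \<noteq> 0"
        by (metis poly_mapping_eqI lookup_zero)
      let ?m = "m - Poly_Mapping.single k 1"
      have "?m + Poly_Mapping.single k 1 = m"
        by (rule poly_mapping_eqI) (use k in \<open>auto simp: lookup_add lookup_minus lookup_single when_def\<close>)
      \<comment> \<open>Characteristic 0 enters here: the coefficient of the derivative at
        \<open>?m\<close> is a nonzero multiple of the coefficient of \<open>p\<close> at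
        \<open>m\<close>.\<close>
      then show ?thesis
        using lookup_pderiv_poly[of k p ?m] by (simp add: pd del: One_nat_def of_nat_Suc)
    qed
    then have p: "p = Poly_Mapping.single 0 (Poly_Mapping.lookup p 0)"
      by (intro poly_mapping_eqI) (auto simp: lookup_single when_def)
    have "eval_poly (\<lambda>_. 0) p = Poly_Mapping.lookup p 0"
      by (subst p) (simp add: eval_poly_single)
    with Suc.prems(2) p show "p = 0" by simp
  qed (auto simp: poly_mapping_eq_iff fun_eq_iff in_keys_iff)
  moreover have "\<exists>d. \<forall>m\<in>Poly_Mapping.keys p. deg m < d"
    using finite_nat_iff_bounded[of "deg ` Poly_Mapping.keys p"] by (auto simp: subset_eq)
  ultimately show ?thesis using assms by blast
qed

lemma polys_eq_0I:
  assumes "p \<in> polys N" "\<And>a. a \<in> affine_space N \<Longrightarrow> eval_poly a p = 0"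
  shows "p = 0"
proof (rule poly_eq_0I)
  fix a
  have "eval_poly a p = eval_poly (restrict a {..<N}) p"
    by (rule eval_poly_cong_polys[OF assms(1)]) auto
  then show "eval_poly a p = 0" using assms(2) by (simp add: affine_space_def)
qed

text \<open>Both sides evaluate to the derivative of the same function on each coordinate line,
  hence agree at every point; the identity principle makes them equal as polynomials.\<close>

lemma pderiv_poly_mult: "pderiv_poly k (p * q) = pderiv_poly k p * q + p * pderiv_poly k q"
proof -
  have "eval_poly a (pderiv_poly k (p * q) - (pderiv_poly k p * q + p * pderiv_poly k q)) = 0" for a
  proof -
    have "((\<lambda>t. eval_poly (a(k := t)) (p * q)) has_field_derivative
        eval_poly a (pderiv_poly k p * q + p * pderiv_poly k q)) (at (a k))"
      unfolding eval_poly_mult eval_poly_add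
      by (rule derivative_eq_intros has_field_derivative_eval_poly_fun_upd refl)+ simp
    then have "eval_poly a (pderiv_poly k (p * q)) = eval_poly a (pderiv_poly k p * q + p * pderiv_poly k q)"
      using has_field_derivative_eval_poly_fun_upd DERIV_unique by blast
    then show ?thesis by (simp add: eval_poly_diff)
  qed
  then show ?thesis using poly_eq_0I eq_iff_diff_eq_0 by blast
qed

section \<open>Rational functions\<close>

lemma regular_atE:
  assumes "regular_at f a"
  obtains p q where "f = Fract p q" "eval_poly a q \<noteq> 0"
  using assms by (auto simp: regular_at_def)

lemma regular_at_Fract: "eval_poly a q \<noteq> 0 \<Longrightarrow> regular_at (Fract p q) a"
  unfolding regular_at_def by (intro exI[of _ p] exI[of _ q]) auto

lemma eval_poly_Fract_eq:
  assumes "Fract p q = Fract p' q'" "q \<noteq> 0" "q' \<noteq> 0"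
  shows "eval_poly a p * eval_poly a q' = eval_poly a p' * eval_poly a q"
  using assms by (simp add: eq_fract eval_poly_mult[symmetric])

text \<open>Cross-multiplication shows that all representations defined at \<open>a\<close> give one
  value, so the definite description is usable.\<close>

lemma eval_rat_Fract:
  assumes q: "eval_poly a q \<noteq> 0"
  shows "eval_rat (Fract p q) a = eval_poly a p / eval_poly a q"
  unfolding eval_rat_def
proof (rule the_equality)
  show "\<exists>p' q'. q' \<noteq> 0 \<and> Fract p q = Fract p' q' \<and> eval_poly a q' \<noteq> 0 \<and>
      eval_poly a p / eval_poly a q = eval_poly a p' / eval_poly a q'"
    using q by (intro exI[of _ p] exI[of _ q]) auto
next
  fix v
  assume "\<exists>p' q'. q' \<noteq> 0 \<and> Fract p q = Fract p' q' \<and> eval_poly a q' \<noteq> 0 \<and>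
      v = eval_poly a p' / eval_poly a q'"
  then obtain p' q' where *: "Fract p q = Fract p' q'" "eval_poly a q' \<noteq> 0"
      "v = eval_poly a p' / eval_poly a q'" by blast
  then have "eval_poly a p * eval_poly a q' = eval_poly a p' * eval_poly a q"
    using q by (intro eval_poly_Fract_eq) auto
  then show "v = eval_poly a p / eval_poly a q"
    using * q by (simp add: frac_eq_eq)
qed

text \<open>Here \<open>q\<close> may vanish at \<open>a\<close>: regularity supplies another
  representation, and cross-multiplying compares the two. A representation chosen for one point can
  so be used at any other point of regularity.\<close>

lemma eval_poly_numerator:
  assumes "regular_at (Fract p q) a" "q \<noteq> 0"
  shows "eval_poly a p = eval_rat (Fract p q) a * eval_poly a q"
proof -
  obtain p' q' where *: "Fract p q = Fract p' q'" "eval_poly a q' \<noteq> 0"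
    using assms(1) by (rule regular_atE)
  then have "eval_poly a p * eval_poly a q' = eval_poly a p' * eval_poly a q"
    using assms(2) by (intro eval_poly_Fract_eq) auto
  with * show ?thesis by (simp add: eval_rat_Fract field_simps)
qed

lemma vanishes_at_iff: "vanishes_at f a \<longleftrightarrow> regular_at f a \<and> eval_rat f a = 0"
proof
  assume "vanishes_at f a"
  then obtain p q where "f = Fract p q" "eval_poly a p = 0" "eval_poly a q \<noteq> 0"
    by (auto simp: vanishes_at_def)
  then show "regular_at f a \<and> eval_rat f a = 0"
    by (simp add: regular_at_Fract eval_rat_Fract)
next
  assume *: "regular_at f a \<and> eval_rat f a = 0"
  then obtain p q where pq: "f = Fract p q" "eval_poly a q \<noteq> 0"
    by (auto elim: regular_atE)
  with * have "eval_poly a p = 0" by (simp add: eval_rat_Fract)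
  with pq show "vanishes_at f a"
    unfolding vanishes_at_def by (intro exI[of _ p] exI[of _ q]) auto
qed

text \<open>The functions regular at \<open>a\<close> form the local ring of that point, and
  evaluation is its residue map; products of nonvanishing denominators do not vanish.\<close>

lemma
  assumes "regular_at f a" "regular_at g a"
  shows regular_at_add: "regular_at (f + g) a"
    and eval_rat_add: "eval_rat (f + g) a = eval_rat f a + eval_rat g a"
    and regular_at_diff: "regular_at (f - g) a"
    and eval_rat_diff: "eval_rat (f - g) a = eval_rat f a - eval_rat g a"
    and regular_at_mult: "regular_at (f * g) a"
    and eval_rat_mult: "eval_rat (f * g) a = eval_rat f a * eval_rat g a"
proof -
  obtain p q p' q' where *: "f = Fract p q" "eval_poly a q \<noteq> 0" "g = Fract p' q'" "eval_poly a q' \<noteq> 0"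
    using assms by (metis regular_atE)
  then have "q \<noteq> 0" "q' \<noteq> 0" by auto
  then have s: "f + g = Fract (p * q' + p' * q) (q * q')" "f - g = Fract (p * q' - p' * q) (q * q')"
    "f * g = Fract (p * p') (q * q')"
    by (simp_all add: *)
  have qq: "eval_poly a (q * q') \<noteq> 0" by (simp add: eval_poly_mult *)
  show "regular_at (f + g) a" "regular_at (f - g) a" "regular_at (f * g) a"
    unfolding s using qq by (auto intro: regular_at_Fract)
  show "eval_rat (f + g) a = eval_rat f a + eval_rat g a"
    "eval_rat (f - g) a = eval_rat f a - eval_rat g a"
    "eval_rat (f * g) a = eval_rat f a * eval_rat g a"
    unfolding s eval_rat_Fract[OF qq] unfolding * eval_rat_Fract[OF *(2)] eval_rat_Fract[OF *(4)]
    using *(2,4) by (simp_all add: eval_poly_add eval_poly_diff eval_poly_mult field_simps)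
qed

lemma regular_at_poly: "regular_at (Fract p 1) a"
  and eval_rat_poly: "eval_rat (Fract p 1) a = eval_poly a p"
  by (simp_all add: regular_at_Fract eval_rat_Fract)

lemma regular_at_0: "regular_at 0 a" and eval_rat_0: "eval_rat 0 a = 0"
  by (simp_all add: Zero_fract_def regular_at_poly eval_rat_poly)

lemma regular_at_1: "regular_at 1 a" and eval_rat_1: "eval_rat 1 a = 1"
  by (simp_all add: One_fract_def regular_at_poly eval_rat_poly)

lemma regular_at_Var: "regular_at (Var i) a" and eval_rat_Var: "eval_rat (Var i) a = a i"
  by (simp_all add: Var_def regular_at_poly eval_rat_poly eval_poly_single)

lemma
  assumes "\<And>i. i \<in> A \<Longrightarrow> regular_at (f i) a"
  shows regular_at_sum: "regular_at (\<Sum>i\<in>A. f i) a"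
    and eval_rat_sum: "eval_rat (\<Sum>i\<in>A. f i) a = (\<Sum>i\<in>A. eval_rat (f i) a)"
proof -
  have "regular_at (\<Sum>i\<in>A. f i) a \<and> eval_rat (\<Sum>i\<in>A. f i) a = (\<Sum>i\<in>A. eval_rat (f i) a)"
    using assms by (induction A rule: infinite_finite_induct)
      (auto simp: regular_at_0 eval_rat_0 regular_at_add eval_rat_add)
  then show "regular_at (\<Sum>i\<in>A. f i) a"
    "eval_rat (\<Sum>i\<in>A. f i) a = (\<Sum>i\<in>A. eval_rat (f i) a)" by auto
qed

lemma
  assumes "\<And>i. i \<in> A \<Longrightarrow> regular_at (f i) a"
  shows regular_at_prod: "regular_at (\<Prod>i\<in>A. f i) a"
    and eval_rat_prod: "eval_rat (\<Prod>i\<in>A. f i) a = (\<Prod>i\<in>A. eval_rat (f i) a)"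
proof -
  have "regular_at (\<Prod>i\<in>A. f i) a \<and> eval_rat (\<Prod>i\<in>A. f i) a = (\<Prod>i\<in>A. eval_rat (f i) a)"
    using assms by (induction A rule: infinite_finite_induct)
      (auto simp: regular_at_1 eval_rat_1 regular_at_mult eval_rat_mult)
  then show "regular_at (\<Prod>i\<in>A. f i) a"
    "eval_rat (\<Prod>i\<in>A. f i) a = (\<Prod>i\<in>A. eval_rat (f i) a)" by auto
qed

lemma
  assumes "regular_at f a"
  shows regular_at_power: "regular_at (f ^ k) a"
    and eval_rat_power: "eval_rat (f ^ k) a = eval_rat f a ^ k"
  using regular_at_prod[of "{..<k}" "\<lambda>_. f" a] eval_rat_prod[of "{..<k}" "\<lambda>_. f" a] assms by simp_all

text \<open>Regularity is required only of the components whose variables occur in \<open>p\<close>;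
  the others may have poles at \<open>a\<close>.\<close>

lemma
  assumes "\<And>i. i \<in> vars p \<Longrightarrow> regular_at (\<sigma> i) a"
  shows regular_at_subst_poly: "regular_at (subst_poly \<sigma> p) a"
    and eval_rat_subst_poly: "eval_rat (subst_poly \<sigma> p) a = eval_poly (\<lambda>i. eval_rat (\<sigma> i) a) p"
proof -
  let ?s = "\<lambda>m. Fract (Poly_Mapping.single 0 (Poly_Mapping.lookup p m)) 1"
  let ?t = "\<lambda>m. \<Prod>i\<in>Poly_Mapping.keys m. \<sigma> i ^ Poly_Mapping.lookup m i"
  have reg: "regular_at (\<sigma> i) a" if "m \<in> Poly_Mapping.keys p" "i \<in> Poly_Mapping.keys m" for i m
    using assms that by (auto simp: vars_def)
  have "regular_at (?s m * ?t m) a \<and> eval_rat (?s m * ?t m) a = Poly_Mapping.lookup p m *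
      (\<Prod>i\<in>Poly_Mapping.keys m. eval_rat (\<sigma> i) a ^ Poly_Mapping.lookup m i)"
    if "m \<in> Poly_Mapping.keys p" for m
    using reg[OF that]
    by (auto simp: regular_at_poly eval_rat_poly eval_poly_single eval_rat_prod eval_rat_power
        eval_rat_mult regular_at_prod regular_at_power intro!: regular_at_mult)
  then show "regular_at (subst_poly \<sigma> p) a"
    "eval_rat (subst_poly \<sigma> p) a = eval_poly (\<lambda>i. eval_rat (\<sigma> i) a) p"
    unfolding subst_poly_def eval_poly_def insertion_def
    by (auto simp: regular_at_sum eval_rat_sum)
qed

section \<open>Rational functions in the first \<open>N\<close> indeterminates\<close>

lemma ratfuns_poly: "p \<in> polys N \<Longrightarrow> Fract p 1 \<in> ratfuns N"
  unfolding ratfuns_def by (intro CollectI exI[of _ p] exI[of _ 1]) simp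

lemma ratfuns_0: "0 \<in> ratfuns N" and ratfuns_1: "1 \<in> ratfuns N"
  by (simp_all add: Zero_fract_def One_fract_def ratfuns_poly)

lemma
  assumes "f \<in> ratfuns N" "g \<in> ratfuns N"
  shows ratfuns_add: "f + g \<in> ratfuns N"
    and ratfuns_diff: "f - g \<in> ratfuns N"
    and ratfuns_mult: "f * g \<in> ratfuns N"
proof -
  obtain p q p' q' where *: "f = Fract p q" "q \<noteq> 0" "g = Fract p' q'" "q' \<noteq> 0"
      and polys: "p \<in> polys N" "q \<in> polys N" "p' \<in> polys N" "q' \<in> polys N"
    using assms by (auto simp: ratfuns_def)
  have s: "f + g = Fract (p * q' + p' * q) (q * q')" "f - g = Fract (p * q' + - (p' * q)) (q * q')"
    "f * g = Fract (p * p') (q * q')"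
    using * by simp_all
  have ratI: "Fract r (q * q') \<in> ratfuns N" if "r \<in> polys N" for r
    unfolding ratfuns_def using that *(2,4) polys
    by (intro CollectI exI[of _ r] exI[of _ "q * q'"]) (auto intro: polys_mult)
  show "f + g \<in> ratfuns N" "f - g \<in> ratfuns N" "f * g \<in> ratfuns N"
    unfolding s using polys by (intro ratI polys_add polys_mult polys_uminus; simp)+
qed

lemma ratfuns_sum: "(\<And>i. i \<in> A \<Longrightarrow> f i \<in> ratfuns N) \<Longrightarrow> (\<Sum>i\<in>A. f i) \<in> ratfuns N"
  by (induction A rule: infinite_finite_induct) (auto intro: ratfuns_add ratfuns_0)

lemma ratfuns_prod: "(\<And>i. i \<in> A \<Longrightarrow> f i \<in> ratfuns N) \<Longrightarrow> (\<Prod>i\<in>A. f i) \<in> ratfuns N"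
  by (induction A rule: infinite_finite_induct) (auto intro: ratfuns_mult ratfuns_1)

lemma ratfuns_power: "f \<in> ratfuns N \<Longrightarrow> f ^ k \<in> ratfuns N"
  by (induction k) (auto intro: ratfuns_mult ratfuns_1)

lemma ratfuns_Var: "i < N \<Longrightarrow> Var i \<in> ratfuns N"
  unfolding Var_def by (intro ratfuns_poly polys_single) simp

lemma ratfuns_subst_poly:
  assumes "\<And>i. i \<in> vars p \<Longrightarrow> \<sigma> i \<in> ratfuns N"
  shows "subst_poly \<sigma> p \<in> ratfuns N"
  unfolding subst_poly_def insertion_def
  by (intro ratfuns_sum ratfuns_mult ratfuns_prod ratfuns_power ratfuns_poly polys_single)
    (use assms in \<open>auto simp: vars_def\<close>)

text \<open>Setting the indeterminates beyond \<open>N\<close> to their values at \<open>a\<close> removes them from a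
  representation of \<open>f\<close> that is regular at \<open>a\<close>.\<close>

lemma ratfuns_regularE:
  assumes "f \<in> ratfuns N" "regular_at f a"
  obtains p q where "f = Fract p q" "p \<in> polys N" "q \<in> polys N" "eval_poly a q \<noteq> 0"
proof -
  obtain p0 q0 where 0: "f = Fract p0 q0" "p0 \<in> polys N" "q0 \<in> polys N" "q0 \<noteq> 0"
    using assms(1) by (auto simp: ratfuns_def)
  obtain p q where 1: "f = Fract p q" "eval_poly a q \<noteq> 0"
    using assms(2) by (rule regular_atE)
  then have "q \<noteq> 0" by auto
  let ?p = "specialize N a p" and ?q = "specialize N a q"
  have q: "eval_poly a ?q \<noteq> 0" using 1 by (simp add: eval_specialize)
  then have "?q \<noteq> 0" by auto
  \<comment> \<open>Specialization fixes \<open>p0\<close> and \<open>q0\<close>, so the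
    cross-multiplied identity survives with only \<open>p\<close> and \<open>q\<close>
    replaced.\<close>
  have "p0 * q = p * q0" using 0 1 \<open>q \<noteq> 0\<close> by (simp add: eq_fract)
  then have "specialize N a (p0 * q) = specialize N a (p * q0)" by simp
  then have "p0 * ?q = ?p * q0" using 0 by (simp add: specialize_mult specialize_id)
  then have "f = Fract ?p ?q" using 0 \<open>?q \<noteq> 0\<close> by (simp add: eq_fract)
  then show thesis using q that specialize_polys by blast
qed

text \<open>Serves to pass between \<open>curve_point\<close> and \<open>ode_point\<close>, which
  agree only in the first \<open>n\<close> coordinates.\<close>

lemma
  assumes "f \<in> ratfuns N" "regular_at f a" and ab: "\<And>i. i < N \<Longrightarrow> a i = b i"
  shows regular_at_cong: "regular_at f b" and eval_rat_cong: "eval_rat f b = eval_rat f a"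
proof -
  obtain p q where *: "f = Fract p q" "p \<in> polys N" "q \<in> polys N" "eval_poly a q \<noteq> 0"
    using assms(1,2) by (rule ratfuns_regularE)
  have "eval_poly b p = eval_poly a p" "eval_poly b q = eval_poly a q"
    using * ab by (auto intro!: eval_poly_cong_polys)
  with * show "regular_at f b" "eval_rat f b = eval_rat f a"
    by (simp_all add: regular_at_Fract eval_rat_Fract)
qed

section \<open>Partial derivatives of rational functions and the chain rule\<close>

lemma pderiv_rat_Fract:
  assumes q: "q \<noteq> 0"
  shows "pderiv_rat k (Fract p q) = Fract (pderiv_poly k p * q - p * pderiv_poly k q) (q * q)"
  unfolding pderiv_rat_def
proof (rule the_equality)
  show "\<exists>p' q'. q' \<noteq> 0 \<and> Fract p q = Fract p' q' \<and>
      Fract (pderiv_poly k p * q - p * pderiv_poly k q) (q * q) =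
      Fract (pderiv_poly k p' * q' - p' * pderiv_poly k q') (q' * q')"
    using q by blast
next
  fix g
  assume "\<exists>p' q'. q' \<noteq> 0 \<and> Fract p q = Fract p' q' \<and>
      g = Fract (pderiv_poly k p' * q' - p' * pderiv_poly k q') (q' * q')"
  then obtain p' q' where q': "q' \<noteq> 0" and eq: "p * q' = p' * q" and
      g: "g = Fract (pderiv_poly k p' * q' - p' * pderiv_poly k q') (q' * q')"
    using q by (auto simp: eq_fract)
  let ?D = "pderiv_poly k"
  \<comment> \<open>Independence of the representation: the differentiated cross-multiplied
    equation, combined with the equation itself, equates the two quotient rules.\<close>
  have "?D (p * q') = ?D (p' * q)" using eq by simp
  then have "?D p * q' + p * ?D q' = ?D p' * q + p' * ?D q"
    by (simp only: pderiv_poly_mult)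
  with eq have "(?D p' * q' - p' * ?D q') * (q * q) = (?D p * q - p * ?D q) * (q' * q')"
    by algebra
  then show "g = Fract (?D p * q - p * ?D q) (q * q)"
    unfolding g using q q' by (simp add: eq_fract)
qed

lemma regular_at_pderiv_rat:
  assumes "regular_at f a"
  shows "regular_at (pderiv_rat k f) a"
proof -
  obtain p q where "f = Fract p q" "eval_poly a q \<noteq> 0"
    using assms by (rule regular_atE)
  moreover from this have "q \<noteq> 0" by auto
  ultimately show ?thesis
    by (simp add: pderiv_rat_Fract regular_at_Fract eval_poly_mult)
qed

lemma has_field_derivative_eval_rat:
  assumes f: "f \<in> ratfuns N" "regular_at f (u x0)"
    and u: "\<And>i. i < N \<Longrightarrow> ((\<lambda>x. u x i) has_field_derivative u' i) (at x0)"
  shows "((\<lambda>x. eval_rat f (u x)) has_field_derivative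
           (\<Sum>k<N. eval_rat (pderiv_rat k f) (u x0) * u' k)) (at x0)"
proof -
  obtain p q where *: "f = Fract p q" "p \<in> polys N" "q \<in> polys N" "eval_poly (u x0) q \<noteq> 0"
    using f by (rule ratfuns_regularE)
  let ?P = "\<lambda>r k. eval_poly (u x0) (pderiv_poly k r)" and ?v = "eval_poly (u x0)"
  have "q \<noteq> 0" using *(4) by auto
  note dq = has_field_derivative_eval_poly[OF *(3) u]
  note dp = has_field_derivative_eval_poly[OF *(2) u]
  \<comment> \<open>The representation was chosen at \<open>x0\<close> alone. By continuity its
    denominator is nonzero nearby, so it computes \<open>eval_rat f\<close> on a neighbourhood,
    which is all that a derivative sees.\<close>
  have "isCont (\<lambda>x. eval_poly (u x) q) x0" by (rule DERIV_isCont[OF dq])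
  then have "((\<lambda>x. eval_poly (u x) q) \<longlongrightarrow> eval_poly (u x0) q) (nhds x0)"
    unfolding isCont_def by (rule tendsto_at_iff_tendsto_nhds[THEN iffD1])
  then have ev: "eventually (\<lambda>x. eval_poly (u x) q \<noteq> 0) (nhds x0)"
    using *(4) by (rule tendsto_imp_eventually_ne)
  have eq: "eventually (\<lambda>x. eval_poly (u x) p / eval_poly (u x) q = eval_rat f (u x)) (nhds x0)"
    using ev by eventually_elim (simp add: * eval_rat_Fract)
  have "((\<lambda>x. eval_poly (u x) p / eval_poly (u x) q) has_field_derivative
      ((\<Sum>k<N. ?P p k * u' k) * ?v q - ?v p * (\<Sum>k<N. ?P q k * u' k)) / (?v q * ?v q)) (at x0)"
    by (rule DERIV_divide[OF dp dq *(4)])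
  also have "((\<Sum>k<N. ?P p k * u' k) * ?v q - ?v p * (\<Sum>k<N. ?P q k * u' k)) / (?v q * ?v q) =
      (\<Sum>k<N. eval_rat (pderiv_rat k f) (u x0) * u' k)"
    using *(4) \<open>q \<noteq> 0\<close>
    by (simp add: * pderiv_rat_Fract eval_rat_Fract eval_poly_mult eval_poly_diff sum_distrib_left
        sum_distrib_right sum_subtractf[symmetric] sum_divide_distrib)
      (simp add: algebra_simps)
  finally show ?thesis
    using DERIV_cong_ev[OF refl eq refl] by blast
qed

section \<open>Jets\<close>

text \<open>\<open>idx ns l 0\<close> is the total length of the first \<open>l\<close> blocks; one
  past the last block it counts all the jet variables.\<close>

lemma idx_length: "idx ns (length ns) 0 = sum_list ns + length ns"
  by (simp add: idx_def sum_list_sum_nth atLeast0LessThan sum_Suc)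

lemma idx_less:
  assumes "i < l" "j \<le> ns ! i"
  shows "idx ns i j < idx ns l 0"
proof -
  have "idx ns i j < (\<Sum>k<Suc i. Suc (ns ! k))" using assms(2) by (simp add: idx_def)
  also have "\<dots> \<le> idx ns l 0"
    unfolding idx_def add_0_right using assms(1) by (intro sum_mono2) auto
  finally show ?thesis .
qed

lemma idx_surj:
  assumes "k < idx ns l 0"
  obtains i j where "i < l" "j \<le> ns ! i" "k = idx ns i j"
proof -
  have "\<exists>i<l. \<exists>j\<le>ns ! i. k = idx ns i j"
    using assms
  proof (induction l)
    case (Suc l)
    show ?case
    proof (cases "k < idx ns l 0")
      case True
      with Suc.IH show ?thesis by (meson less_Suc_eq)
    next
      case False
      with Suc.prems have "k - idx ns l 0 \<le> ns ! l" "k = idx ns l (k - idx ns l 0)"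
        by (auto simp: idx_def)
      then show ?thesis by blast
    qed
  qed (simp add: idx_def)
  then show thesis using that by blast
qed

lemma jet_nth:
  assumes "i < length ns" "j \<le> ns ! i"
  shows "jet ns y x ! idx ns i j = (deriv ^^ j) (y i) x"
proof -
  define g where "g i = map (\<lambda>j. (deriv ^^ j) (y i) x) [0..<Suc (ns ! i)]" for i
  have len: "length (concat (map g [0..<l])) = idx ns l 0" for l
    by (induction l) (simp_all add: g_def idx_def)
  \<comment> \<open>Induction on the number of blocks: the position lies in the last block, or is
    unaffected by appending it.\<close>
  have "concat (map g [0..<l]) ! idx ns i j = (deriv ^^ j) (y i) x" if "i < l" for l
    using that
  proof (induction l)
    case (Suc l)
    show ?case
    proof (cases "i = l")
      case True
      have "idx ns l j = idx ns l 0 + j" by (simp add: idx_def)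
      then have "concat (map g [0..<Suc l]) ! idx ns l j = g l ! j"
        by (simp add: nth_append len)
      also have "\<dots> = (deriv ^^ j) (y l) x"
        using assms(2) True unfolding g_def by (subst nth_map) (auto simp del: upt_Suc)
      finally show ?thesis using True by simp
    next
      case False
      then have "i < l" using Suc.prems by simp
      then show ?thesis
        using Suc.IH idx_less[OF \<open>i < l\<close> assms(2)] by (simp add: nth_append len)
    qed
  qed simp
  then show ?thesis
    using assms(1) unfolding jet_def g_def[symmetric] by blast
qed

section \<open>Rational parametrizations\<close>

text \<open>The points of \<open>rat_dom\<close> are dense, so \<open>p(Q)\<close> vanishes as a rational function. This covers
  points \<open>a\<close> at which only the components of \<open>Q\<close> occurring in \<open>p\<close> are defined.\<close>

lemma parametrization_satisfies_relations:
  assumes Q: "rational_parametrization n m V Q"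
    and p: "vars p \<subseteq> {..<n + m}" "\<And>b. b \<in> V \<Longrightarrow> eval_poly b p = 0"
    and a: "\<And>j. j \<in> vars p \<Longrightarrow> regular_at (Q j) a"
  shows "eval_poly (\<lambda>j. eval_rat (Q j) a) p = 0"
proof -
  have QV: "zariski_closure (n + m) (rat_map (n + m) Q ` rat_dom n (n + m) Q) = V"
    and Qrat: "\<And>j. j < n + m \<Longrightarrow> Q j \<in> ratfuns n"
    using Q by (auto simp: rational_parametrization_def)
  have "subst_poly Q p \<in> ratfuns n"
    using p(1) Qrat by (intro ratfuns_subst_poly) auto
  then obtain r s where rs: "subst_poly Q p = Fract r s" "r \<in> polys n" "s \<in> polys n" "s \<noteq> 0"
    by (auto simp: ratfuns_def)
  have "\<forall>j. \<exists>u v. j < n + m \<longrightarrow> Q j = Fract u v \<and> v \<in> polys n \<and> v \<noteq> 0"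
    using Qrat by (force simp: ratfuns_def)
  then obtain u v where uv: "\<And>j. j < n + m \<Longrightarrow> Q j = Fract (u j) (v j)"
      "\<And>j. j < n + m \<Longrightarrow> v j \<in> polys n" "\<And>j. j < n + m \<Longrightarrow> v j \<noteq> 0"
    by metis
  \<comment> \<open>The extra factors make \<open>t\<close> vanish wherever a chosen representation
    is undefined; at all other points \<open>Q\<close> is defined and lands in \<open>V\<close>,
    which makes \<open>r\<close> vanish. Being nonzero polynomials, they cancel afterwards.\<close>
  define t where "t = r * s * (\<Prod>j<n + m. v j)"
  have "t = 0"
  proof (rule polys_eq_0I)
    show "t \<in> polys n"
      unfolding t_def using rs uv by (intro polys_mult polys_prod) auto
    fix c assume c: "c \<in> affine_space n"
    show "eval_poly c t = 0"
    proof (cases "eval_poly c s = 0 \<or> (\<exists>j<n + m. eval_poly c (v j) = 0)")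
      case True
      then show ?thesis by (auto simp: t_def eval_poly_mult eval_poly_prod)
    next
      case False
      then have reg: "regular_at (Q j) c" if "j < n + m" for j
        using that uv(1) by (auto simp: regular_at_Fract)
      then have "rat_map (n + m) Q c \<in> rat_map (n + m) Q ` rat_dom n (n + m) Q"
        using c by (auto simp: rat_dom_def)
      then have "rat_map (n + m) Q c \<in> V"
        unfolding QV[symmetric] by (auto simp: zariski_closure_def rat_map_def affine_space_def)
      then have "0 = eval_poly (rat_map (n + m) Q c) p" using p(2) by simp
      also have "\<dots> = eval_poly (\<lambda>j. eval_rat (Q j) c) p"
        using p(1) by (intro eval_poly_cong) (auto simp: rat_map_def)
      also have "\<dots> = eval_rat (subst_poly Q p) c"
        using p(1) reg by (intro eval_rat_subst_poly[symmetric]) auto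
      also have "\<dots> = eval_poly c r / eval_poly c s"
        using False rs by (simp add: eval_rat_Fract)
      finally show ?thesis using False by (simp add: t_def eval_poly_mult)
    qed
  qed
  then have "r = 0" using rs(4) uv(3) by (auto simp: t_def)
  then have "subst_poly Q p = 0" using rs by (simp add: fract_collapse)
  then show ?thesis
    using a by (simp add: eval_rat_subst_poly[symmetric] eval_rat_0)
qed

text \<open>Clearing denominators turns \<open>Q(R(b)) = b\<close> into polynomial equations, which extend from the
  dense set on which they hold by assumption.\<close>

lemma rational_inverse_pointwise:
  assumes Q: "rational_parametrization n m V Q" and R: "rational_inverse n m V Q R"
    and b: "b \<in> V" "b \<in> rat_dom (n + m) n R" "rat_map n R b \<in> rat_dom n (n + m) Q"
    and j: "j < n + m"
  shows "eval_rat (Q j) (rat_map n R b) = b j"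
proof -
  define S where "S = {b \<in> V \<inter> rat_dom (n + m) n R. rat_map n R b \<in> rat_dom n (n + m) Q \<and>
          rat_map (n + m) Q (rat_map n R b) = b}"
  have Rrat: "\<And>k. k < n \<Longrightarrow> R k \<in> ratfuns (n + m)" and VS: "V \<subseteq> zariski_closure (n + m) S"
    using R by (auto simp: rational_inverse_def S_def)
  have "Q j \<in> ratfuns n" "regular_at (Q j) (rat_map n R b)"
    using Q b(3) j by (auto simp: rational_parametrization_def rat_dom_def)
  then obtain P q where Pq: "Q j = Fract P q" "P \<in> polys n" "q \<in> polys n"
      "eval_poly (rat_map n R b) q \<noteq> 0"
    by (rule ratfuns_regularE)
  have q0: "q \<noteq> 0" using Pq(4) by auto
  have vars: "vars P \<subseteq> {..<n}" "vars q \<subseteq> {..<n}" using Pq by (auto simp: polys_def)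
  \<comment> \<open>This is Q_j(R) minus the j-th coordinate, multiplied by \<open>q(R)\<close>. The
    representation \<open>P\<close>/\<open>q\<close> was chosen at R(b), so that
    \<open>q(R(b))\<close> can be cancelled at the end.\<close>
  define h where "h = subst_poly R P - Var j * subst_poly R q"
  have h: "regular_at h c \<and> eval_rat h c =
      eval_poly (rat_map n R c) P - c j * eval_poly (rat_map n R c) q"
    if "c \<in> rat_dom (n + m) n R" for c
  proof -
    have subst: "regular_at (subst_poly R p) c \<and>
        eval_rat (subst_poly R p) c = eval_poly (rat_map n R c) p" if "vars p \<subseteq> {..<n}" for p
    proof -
      have reg: "\<And>k. k \<in> vars p \<Longrightarrow> regular_at (R k) c"
        using that \<open>c \<in> rat_dom (n + m) n R\<close> by (auto simp: rat_dom_def)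
      have "eval_poly (\<lambda>k. eval_rat (R k) c) p = eval_poly (rat_map n R c) p"
        using that by (intro eval_poly_cong) (auto simp: rat_map_def)
      with reg show ?thesis by (simp add: regular_at_subst_poly eval_rat_subst_poly)
    qed
    show ?thesis
      unfolding h_def using subst[OF vars(1)] subst[OF vars(2)]
      by (simp add: regular_at_diff regular_at_mult regular_at_Var eval_rat_diff eval_rat_mult eval_rat_Var)
  qed
  have "h \<in> ratfuns (n + m)"
    unfolding h_def using vars Rrat j
    by (intro ratfuns_diff ratfuns_mult ratfuns_Var ratfuns_subst_poly) auto
  then obtain num den where nd: "h = Fract num den" "num \<in> polys (n + m)" "den \<in> polys (n + m)"
      "eval_poly b den \<noteq> 0"
    using h b(2) by (metis ratfuns_regularE)
  \<comment> \<open>The factor \<open>den\<close> covers the points of \<open>S\<close> where this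
    representation of \<open>h\<close> is undefined; it is nonzero at \<open>b\<close>.\<close>
  have "eval_poly c (num * den) = 0" if c: "c \<in> S" for c
  proof (cases "eval_poly c den = 0")
    case False
    have "regular_at (Q j) (rat_map n R c)" using c j by (auto simp: S_def rat_dom_def)
    \<comment> \<open>At points other than \<open>b\<close>, \<open>q(R(c))\<close> may be zero, so
      the numerator is compared without dividing.\<close>
    then have "eval_poly (rat_map n R c) P = eval_rat (Q j) (rat_map n R c) * eval_poly (rat_map n R c) q"
      unfolding Pq(1) using q0 by (rule eval_poly_numerator)
    also have "eval_rat (Q j) (rat_map n R c) = rat_map (n + m) Q (rat_map n R c) j"
      using j by (simp add: rat_map_def)
    also have "rat_map (n + m) Q (rat_map n R c) = c" using c by (simp add: S_def)
    finally have "eval_rat h c = 0" using h c by (simp add: S_def)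
    then show ?thesis using False nd by (simp add: eval_rat_Fract eval_poly_mult)
  qed (simp add: eval_poly_mult)
  moreover have "num * den \<in> polys (n + m)" using nd by (intro polys_mult)
  ultimately have "eval_poly b (num * den) = 0"
    using VS b(1) by (auto simp: zariski_closure_def)
  then have "eval_rat h b = 0" using nd by (simp add: eval_rat_Fract eval_poly_mult)
  then have "eval_poly (rat_map n R b) P = b j * eval_poly (rat_map n R b) q"
    using h b(2) by simp
  then show ?thesis using Pq by (simp add: eval_rat_Fract)
qed

section \<open>Transformation of the differential system\<close>

lemma holomorphic_eval_rat:
  assumes "open D" "f \<in> ratfuns N" "\<And>x. x \<in> D \<Longrightarrow> regular_at f (u x)"
    and u: "\<And>i. i < N \<Longrightarrow> (\<lambda>x. u x i) holomorphic_on D"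
  shows "(\<lambda>x. eval_rat f (u x)) holomorphic_on D"
proof -
  have "(\<lambda>x. eval_rat f (u x)) field_differentiable (at x)" if x: "x \<in> D" for x
    using has_field_derivative_eval_rat[where u = u, OF assms(2) assms(3)[OF x],
        of "\<lambda>i. deriv (\<lambda>x. u x i) x"]
      holomorphic_derivI[OF u \<open>open D\<close> x]
    unfolding field_differentiable_def by blast
  then show ?thesis
    using \<open>open D\<close> by (auto simp: holomorphic_on_open field_differentiable_def)
qed

lemma ode_point_eq_curve_point: "k < n \<Longrightarrow> ode_point n w x k = curve_point n w x k"
  by (simp add: ode_point_def curve_point_def)

lemma
  assumes Q: "\<And>j. j < n + m \<Longrightarrow> Q j \<in> ratfuns n" and f: "f \<in> polys (n + m + 1)"
    and reg: "\<And>j. j \<in> vars f \<inter> {..<n + m} \<Longrightarrow> regular_at (Q j) (curve_point n w x)"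
  shows regular_at_G_eq: "regular_at (G_eq n m Q f) (ode_point n w x)"
    and eval_rat_G_eq: "eval_rat (G_eq n m Q f) (ode_point n w x) =
          eval_poly ((\<lambda>j. eval_rat (Q j) (curve_point n w x))(n + m := x)) f"
proof -
  let ?\<sigma> = "\<lambda>j. if j < n + m then Q j else Var (2 * n)"
  have Qode: "regular_at (Q j) (ode_point n w x)"
      "eval_rat (Q j) (ode_point n w x) = eval_rat (Q j) (curve_point n w x)"
    if "j \<in> vars f" "j < n + m" for j
    using regular_at_cong[OF Q reg, of j "ode_point n w x"]
      eval_rat_cong[OF Q reg, of j "ode_point n w x"] that
    by (simp_all add: ode_point_eq_curve_point)
  have \<sigma>: "regular_at (?\<sigma> j) (ode_point n w x)" if "j \<in> vars f" for j
    using that Qode by (simp add: regular_at_Var)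
  then show "regular_at (G_eq n m Q f) (ode_point n w x)"
    unfolding G_eq_def by (rule regular_at_subst_poly)
  have "eval_rat (G_eq n m Q f) (ode_point n w x) =
      eval_poly (\<lambda>j. eval_rat (?\<sigma> j) (ode_point n w x)) f"
    unfolding G_eq_def using \<sigma> by (rule eval_rat_subst_poly)
  also have "\<dots> = eval_poly ((\<lambda>j. eval_rat (Q j) (curve_point n w x))(n + m := x)) f"
    using f Qode by (intro eval_poly_cong)
      (auto simp: polys_def subset_eq less_Suc_eq eval_rat_Var ode_point_def)
  finally show "eval_rat (G_eq n m Q f) (ode_point n w x) =
          eval_poly ((\<lambda>j. eval_rat (Q j) (curve_point n w x))(n + m := x)) f" .
qed

text \<open>By the chain rule the sum in \<open>D_eq\<close> is the derivative of the j-th component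
  along the curve. That component must be regular on all of \<open>D\<close>, since it is
  differentiated; the next one only at \<open>x\<close>.\<close>

lemma
  assumes "open D" "x \<in> D" and w: "\<And>k. k < n \<Longrightarrow> w k holomorphic_on D"
    and Q: "Q (idx ns i j) \<in> ratfuns n" "Q (idx ns i (Suc j)) \<in> ratfuns n"
    and reg: "\<And>x. x \<in> D \<Longrightarrow> regular_at (Q (idx ns i j)) (curve_point n w x)"
      "regular_at (Q (idx ns i (Suc j))) (curve_point n w x)"
  shows regular_at_D_eq: "regular_at (D_eq n ns Q i j) (ode_point n w x)"
    and eval_rat_D_eq: "eval_rat (D_eq n ns Q i j) (ode_point n w x) =
          eval_rat (Q (idx ns i (Suc j))) (curve_point n w x) -
          deriv (\<lambda>x. eval_rat (Q (idx ns i j)) (curve_point n w x)) x"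
proof -
  let ?a = "ode_point n w"
  let ?s = "\<lambda>k. pderiv_rat k (Q (idx ns i j)) * Var (n + k)"
  have Qj: "regular_at (Q (idx ns i j)) (?a x)"
      "eval_rat (Q (idx ns i j)) (?a x) = eval_rat (Q (idx ns i j)) (curve_point n w x)"
    if "x \<in> D" for x
    using regular_at_cong[OF Q(1) reg(1)[OF that], of "?a x"] eval_rat_cong[OF Q(1) reg(1)[OF that], of "?a x"]
    by (simp_all add: ode_point_eq_curve_point)
  have QSuc: "regular_at (Q (idx ns i (Suc j))) (?a x)"
      "eval_rat (Q (idx ns i (Suc j))) (?a x) = eval_rat (Q (idx ns i (Suc j))) (curve_point n w x)"
    using regular_at_cong[OF Q(2) reg(2), of "?a x"] eval_rat_cong[OF Q(2) reg(2), of "?a x"]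
    by (simp_all add: ode_point_eq_curve_point)
  have s: "regular_at (?s k) (?a x)" for k
    using \<open>x \<in> D\<close> by (intro regular_at_mult regular_at_pderiv_rat Qj regular_at_Var)
  show "regular_at (D_eq n ns Q i j) (?a x)"
    unfolding D_eq_def by (intro regular_at_diff regular_at_sum s QSuc)
  have "((\<lambda>x. eval_rat (Q (idx ns i j)) (?a x)) has_field_derivative
      (\<Sum>k<n. eval_rat (pderiv_rat k (Q (idx ns i j))) (?a x) * deriv (w k) x)) (at x)"
  proof (rule has_field_derivative_eval_rat[where u = ?a, OF Q(1) Qj(1)[OF \<open>x \<in> D\<close>]])
    show "((\<lambda>x. ?a x k) has_field_derivative deriv (w k) x) (at x)" if "k < n" for k
      using holomorphic_derivI[OF w \<open>open D\<close> \<open>x \<in> D\<close>] that by (simp add: ode_point_def)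
  qed
  then have "((\<lambda>x. eval_rat (Q (idx ns i j)) (curve_point n w x)) has_field_derivative
      (\<Sum>k<n. eval_rat (pderiv_rat k (Q (idx ns i j))) (?a x) * deriv (w k) x)) (at x)"
    using \<open>open D\<close> \<open>x \<in> D\<close> by (rule has_field_derivative_transform_within_open) (rule Qj)
  then have "deriv (\<lambda>x. eval_rat (Q (idx ns i j)) (curve_point n w x)) x =
      (\<Sum>k<n. eval_rat (pderiv_rat k (Q (idx ns i j))) (?a x) * deriv (w k) x)"
    by (rule DERIV_imp_deriv)
  also have "\<dots> = (\<Sum>k<n. eval_rat (?s k) (?a x))"
    using Qj(1)[OF \<open>x \<in> D\<close>]
    by (intro sum.cong) (simp_all add: eval_rat_mult regular_at_pderiv_rat regular_at_Var eval_rat_Var ode_point_def)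
  also have "\<dots> = eval_rat (\<Sum>k<n. ?s k) (?a x)"
    using s by (simp add: eval_rat_sum)
  finally show "eval_rat (D_eq n ns Q i j) (?a x) =
          eval_rat (Q (idx ns i (Suc j))) (curve_point n w x) -
          deriv (\<lambda>x. eval_rat (Q (idx ns i j)) (curve_point n w x)) x"
    unfolding D_eq_def using QSuc s by (simp add: eval_rat_diff regular_at_sum)
qed

lemma deriv_cong_open:
  assumes "open D" "x \<in> D" "\<And>x. x \<in> D \<Longrightarrow> f x = g x"
  shows "deriv f x = deriv g x"
  using assms by (intro deriv_cong_ev) (auto simp: eventually_nhds)

text \<open>Regularity comes from two sources: the hypothesis covers the components replacing the
  jet variables, and \<open>solves_G\<close> those of the radicals that occur in the
  equations.\<close>

lemma solves_G_imp_solves_F: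
  assumes n: "n = sum_list ns + length ns"
    and F: "\<And>k. k < N \<Longrightarrow> F k \<in> polys (n + m + 1)"
    and Q: "rational_parametrization n m V Q"
    and "open D" and G: "solves_G n m ns N F Q D w"
    and reg: "\<And>x j. x \<in> D \<Longrightarrow> j < n \<Longrightarrow> regular_at (Q j) (curve_point n w x)"
  shows "solves_F n m V ns N F D
          (\<lambda>i x. eval_rat (Q (idx ns i 0)) (curve_point n w x))
          (\<lambda>i x. eval_rat (Q (n + i)) (curve_point n w x))"
    (is "solves_F n m V ns N F D ?y ?d")
proof -
  have Qrat: "\<And>j. j < n + m \<Longrightarrow> Q j \<in> ratfuns n"
    using Q by (auto simp: rational_parametrization_def)
  have w: "\<And>k. k < n \<Longrightarrow> w k holomorphic_on D"
    and Greg: "\<And>x k j. x \<in> D \<Longrightarrow> k < N \<Longrightarrow> j \<in> vars (F k) \<inter> {..<n + m} \<Longrightarrow>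
        regular_at (Q j) (curve_point n w x)"
    and Gz: "\<And>x k. x \<in> D \<Longrightarrow> k < N \<Longrightarrow> eval_rat (G_eq n m Q (F k)) (ode_point n w x) = 0"
    and Dz: "\<And>x i j. x \<in> D \<Longrightarrow> i < length ns \<Longrightarrow> j < ns ! i \<Longrightarrow>
        eval_rat (D_eq n ns Q i j) (ode_point n w x) = 0"
    using G by (auto simp: solves_G_def vanishes_at_iff)
  have idx_n: "idx ns i j < n" if "i < length ns" "j \<le> ns ! i" for i j
    using idx_less[OF that] by (simp add: idx_length n)
  have hol: "(\<lambda>x. eval_rat (Q j) (curve_point n w x)) holomorphic_on D"
    if "j < n + m" "\<And>x. x \<in> D \<Longrightarrow> regular_at (Q j) (curve_point n w x)" for j
    using \<open>open D\<close> Qrat[OF that(1)] that(2) w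
    by (intro holomorphic_eval_rat) (auto simp: curve_point_def)
  \<comment> \<open>The point \<open>x\<close> is generalized because the induction step
    differentiates, and so needs the induction hypothesis throughout \<open>D\<close>.\<close>
  have derivs: "(deriv ^^ j) (?y i) x = eval_rat (Q (idx ns i j)) (curve_point n w x)"
    if "i < length ns" "j \<le> ns ! i" "x \<in> D" for i j x
    using that(2,3)
  proof (induction j arbitrary: x)
    case (Suc j)
    have "(deriv ^^ Suc j) (?y i) x = deriv (\<lambda>x. eval_rat (Q (idx ns i j)) (curve_point n w x)) x"
      unfolding funpow.simps o_def using \<open>open D\<close> Suc.prems(2)
      by (rule deriv_cong_open) (use Suc.IH Suc.prems(1) in auto)
    also have "\<dots> = eval_rat (Q (idx ns i (Suc j))) (curve_point n w x)"
      using Dz[of x i j] eval_rat_D_eq[of D x n w Q ns i j] \<open>open D\<close> Suc.prems that(1) w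
        idx_n[of i j] idx_n[of i "Suc j"] Qrat reg by simp
    finally show ?case .
  qed simp
  have jet: "jet ns ?y x ! k = eval_rat (Q k) (curve_point n w x)" if x: "x \<in> D" and "k < n" for x k
  proof -
    obtain i j where "i < length ns" "j \<le> ns ! i" "k = idx ns i j"
      using \<open>k < n\<close> idx_surj[of k ns "length ns"] by (auto simp: idx_length n)
    then show ?thesis using derivs x by (simp add: jet_nth)
  qed
  \<comment> \<open>For the radical coordinates this holds by the choice of \<open>?d\<close>, even
    at poles, where \<open>eval_rat\<close> has an unspecified value.\<close>
  have point: "jet_point n m ns ?y ?d x j = eval_rat (Q j) (curve_point n w x)"
    if "x \<in> D" "j < n + m" for x j
    using that jet by (auto simp: jet_point_def)
  have rad: "regular_at (Q (n + i)) (curve_point n w x)" if "i \<in> radicals_of n m N F" "x \<in> D" for i x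
    using that Greg by (auto simp: radicals_of_def)
  show ?thesis
    unfolding solves_F_def
  proof (intro conjI allI ballI impI)
    fix i assume "i < length ns"
    then show "?y i holomorphic_on D" using idx_n[of i 0] reg by (intro hol) auto
  next
    fix i assume "i \<in> radicals_of n m N F"
    then show "?d i holomorphic_on D" using rad by (intro hol) (auto simp: radicals_of_def)
  next
    fix x p
    assume x: "x \<in> D" and vars: "vars p \<subseteq> {..<n} \<union> (+) n ` radicals_of n m N F"
      and V: "\<forall>b\<in>V. eval_poly b p = 0"
    have vars': "vars p \<subseteq> {..<n + m}" using vars by (auto simp: radicals_of_def)
    have "eval_poly (jet_point n m ns ?y ?d x) p = eval_poly (\<lambda>j. eval_rat (Q j) (curve_point n w x)) p"
      using vars' point[OF x] by (intro eval_poly_cong) auto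
    also have "\<dots> = 0"
      using vars V reg[OF x] rad[OF _ x] vars'
      by (intro parametrization_satisfies_relations[OF Q]) auto
    finally show "eval_poly (jet_point n m ns ?y ?d x) p = 0" .
  next
    fix x k assume x: "x \<in> D" and k: "k < N"
    have "eval_poly ((jet_point n m ns ?y ?d x)(n + m := x)) (F k) =
        eval_poly ((\<lambda>j. eval_rat (Q j) (curve_point n w x))(n + m := x)) (F k)"
      using point[OF x] by (intro eval_poly_cong_polys[OF F[OF k]]) auto
    also have "\<dots> = eval_rat (G_eq n m Q (F k)) (ode_point n w x)"
      using Qrat F[OF k] Greg[OF x k] by (rule eval_rat_G_eq[symmetric])
    finally show "eval_poly ((jet_point n m ns ?y ?d x)(n + m := x)) (F k) = 0"
      using Gz[OF x k] by simp
  qed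
qed

lemma solves_F_imp_solves_G:
  assumes n: "n = sum_list ns + length ns"
    and F: "\<And>k. k < N \<Longrightarrow> F k \<in> polys (n + m + 1)"
    and Q: "rational_parametrization n m V Q" and R: "rational_inverse n m V Q R"
    and "open D" and S: "solves_F n m V ns N F D y d"
    and d: "\<And>i. i < m \<Longrightarrow> d i holomorphic_on D"
    and V: "\<And>x. x \<in> D \<Longrightarrow> jet_point n m ns y d x \<in> V"
    and domR: "\<And>x. x \<in> D \<Longrightarrow> jet_point n m ns y d x \<in> rat_dom (n + m) n R"
    and domQ: "\<And>x. x \<in> D \<Longrightarrow> rat_map n R (jet_point n m ns y d x) \<in> rat_dom n (n + m) Q"
  shows "solves_G n m ns N F Q D (\<lambda>k x. eval_rat (R k) (jet_point n m ns y d x))"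
    (is "solves_G n m ns N F Q D ?w")
proof -
  have Qrat: "\<And>j. j < n + m \<Longrightarrow> Q j \<in> ratfuns n"
    using Q by (auto simp: rational_parametrization_def)
  have Rrat: "\<And>k. k < n \<Longrightarrow> R k \<in> ratfuns (n + m)"
    using R by (auto simp: rational_inverse_def)
  have y: "\<And>i. i < length ns \<Longrightarrow> y i holomorphic_on D"
    and Fz: "\<And>x k. x \<in> D \<Longrightarrow> k < N \<Longrightarrow>
        eval_poly ((jet_point n m ns y d x)(n + m := x)) (F k) = 0"
    using S by (auto simp: solves_F_def)
  have curve: "curve_point n ?w x = rat_map n R (jet_point n m ns y d x)" for x
    by (simp add: curve_point_def rat_map_def)
  have reg: "regular_at (Q j) (curve_point n ?w x)" if "x \<in> D" "j < n + m" for x j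
    using domQ[OF that(1)] that(2) by (simp add: curve rat_dom_def)
  have point: "eval_rat (Q j) (curve_point n ?w x) = jet_point n m ns y d x j"
    if "x \<in> D" "j < n + m" for x j
    unfolding curve using rational_inverse_pointwise[OF Q R V domR domQ] that by blast
  have idx_n: "idx ns i j < n" if "i < length ns" "j \<le> ns ! i" for i j
    using idx_less[OF that] by (simp add: idx_length n)
  have jet: "jet_point n m ns y d x (idx ns i j) = (deriv ^^ j) (y i) x"
    if "i < length ns" "j \<le> ns ! i" for i j x
    using idx_n[OF that] jet_nth[OF that] by (simp add: jet_point_def)
  \<comment> \<open>Higher derivatives of holomorphic functions on an open set are holomorphic; this
    makes the composite with \<open>R\<close> holomorphic.\<close>
  have jet_hol: "(\<lambda>x. jet_point n m ns y d x k) holomorphic_on D" if "k < n + m" for k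
  proof (cases "k < n")
    case True
    then obtain i j where ij: "i < length ns" "j \<le> ns ! i" "k = idx ns i j"
      using idx_surj[of k ns "length ns"] by (auto simp: idx_length n)
    have "(deriv ^^ j) (y i) holomorphic_on D"
      using y[OF ij(1)] \<open>open D\<close> by (rule holomorphic_higher_deriv)
    then show ?thesis using ij jet by simp
  next
    case False
    then show ?thesis using that d by (simp add: jet_point_def)
  qed
  have w: "?w k holomorphic_on D" if "k < n" for k
    using \<open>open D\<close> Rrat[OF that] domR jet_hol that
    by (intro holomorphic_eval_rat) (auto simp: rat_dom_def)
  show ?thesis
    unfolding solves_G_def
  proof (intro conjI allI ballI impI)
    fix k assume "k < n"
    then show "?w k holomorphic_on D" by (rule w)
  next
    fix x k j assume "x \<in> D" "k < N" "j \<in> vars (F k) \<inter> {..<n + m}"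
    then show "regular_at (Q j) (curve_point n ?w x)" using reg by simp
  next
    fix x k assume x: "x \<in> D" and k: "k < N"
    have reg': "regular_at (Q j) (curve_point n ?w x)" if "j \<in> vars (F k) \<inter> {..<n + m}" for j
      using that reg x by simp
    have "eval_rat (G_eq n m Q (F k)) (ode_point n ?w x) =
        eval_poly ((\<lambda>j. eval_rat (Q j) (curve_point n ?w x))(n + m := x)) (F k)"
      using Qrat F[OF k] reg' by (rule eval_rat_G_eq)
    also have "\<dots> = eval_poly ((jet_point n m ns y d x)(n + m := x)) (F k)"
      using point[OF x] by (intro eval_poly_cong_polys[OF F[OF k]]) auto
    finally show "vanishes_at (G_eq n m Q (F k)) (ode_point n ?w x)"
      using Fz[OF x k] regular_at_G_eq[OF Qrat F[OF k] reg'] by (simp add: vanishes_at_iff)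
  next
    fix x i j assume x: "x \<in> D" and ij: "i < length ns" "j < ns ! i"
    then have idx: "idx ns i j < n" "idx ns i (Suc j) < n" by (auto intro: idx_n)
    \<comment> \<open>Q(w(x)) is the jet at every point of the open set \<open>D\<close>, so the
      identity may be differentiated.\<close>
    have "deriv (\<lambda>x. eval_rat (Q (idx ns i j)) (curve_point n ?w x)) x = deriv ((deriv ^^ j) (y i)) x"
      using \<open>open D\<close> x
    proof (rule deriv_cong_open)
      fix x assume "x \<in> D"
      then show "eval_rat (Q (idx ns i j)) (curve_point n ?w x) = (deriv ^^ j) (y i) x"
        using point idx jet ij by simp
    qed
    also have "\<dots> = eval_rat (Q (idx ns i (Suc j))) (curve_point n ?w x)"
      using point[OF x] idx jet[of i "Suc j" x] ij by simp
    finally show "vanishes_at (D_eq n ns Q i j) (ode_point n ?w x)"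
      using regular_at_D_eq[of D x n ?w Q ns i j] eval_rat_D_eq[of D x n ?w Q ns i j]
        \<open>open D\<close> x w Qrat reg idx by (simp add: vanishes_at_iff)
  qed
qed

theorem theorem3p6:
  fixes ns :: "nat list" and n m N :: nat
    and U :: "(nat \<Rightarrow> complex) set" and \<delta> :: "nat \<Rightarrow> (nat \<Rightarrow> complex) \<Rightarrow> complex" and e :: "nat \<Rightarrow> nat"
    and F :: "nat \<Rightarrow> mpoly" and Q :: "nat \<Rightarrow> ratfun" and V :: "(nat \<Rightarrow> complex) set"
  assumes "n = sum_list ns + length ns"
    and "radical_tower n m U \<delta> e"
    and "V = tower_variety n m U \<delta>"
    and "\<And>k. k < N \<Longrightarrow> F k \<in> polys (n + m + 1)"
    and "rational_parametrization n m V Q"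
  shows
    "(\<forall>D w. open D \<longrightarrow> solves_G n m ns N F Q D w \<longrightarrow>
        (\<forall>x\<in>D. \<forall>j<n. regular_at (Q j) (curve_point n w x)) \<longrightarrow>
        solves_F n m V ns N F D
          (\<lambda>i x. eval_rat (Q (idx ns i 0)) (curve_point n w x))
          (\<lambda>i x. eval_rat (Q (n + i)) (curve_point n w x)))
     \<and>
     (\<forall>R D y d. rational_inverse n m V Q R \<longrightarrow> open D \<longrightarrow>
        solves_F n m V ns N F D y d \<longrightarrow>
        (\<forall>i<m. d i holomorphic_on D) \<longrightarrow>
        (\<forall>x\<in>D. jet_point n m ns y d x \<in> V) \<longrightarrow>
        (\<forall>x\<in>D. jet_point n m ns y d x \<in> rat_dom (n + m) n R) \<longrightarrow>
        (\<forall>x\<in>D. rat_map n R (jet_point n m ns y d x) \<in> rat_dom n (n + m) Q) \<longrightarrow>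
        solves_G n m ns N F Q D (\<lambda>k x. eval_rat (R k) (jet_point n m ns y d x)))"
proof (intro conjI allI impI)
  fix D w
  assume "open D" "solves_G n m ns N F Q D w"
    and "\<forall>x\<in>D. \<forall>j<n. regular_at (Q j) (curve_point n w x)"
  then show "solves_F n m V ns N F D
      (\<lambda>i x. eval_rat (Q (idx ns i 0)) (curve_point n w x))
      (\<lambda>i x. eval_rat (Q (n + i)) (curve_point n w x))"
    by (intro solves_G_imp_solves_F assms(1,4,5)) simp_all
next
  fix R D y d
  assume "rational_inverse n m V Q R" "open D" "solves_F n m V ns N F D y d"
    and "\<forall>i<m. d i holomorphic_on D"
    and "\<forall>x\<in>D. jet_point n m ns y d x \<in> V"
    and "\<forall>x\<in>D. jet_point n m ns y d x \<in> rat_dom (n + m) n R"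
    and "\<forall>x\<in>D. rat_map n R (jet_point n m ns y d x) \<in> rat_dom n (n + m) Q"
  then show "solves_G n m ns N F Q D (\<lambda>k x. eval_rat (R k) (jet_point n m ns y d x))"
    by (intro solves_F_imp_solves_G[where V = V and d = d and y = y and R = R] assms(1,4,5)) simp_all
qed

end
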